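(* Let $(H,\mu_H,\Delta_H)$ be a bialgebra over a field $k$, $\alpha_H:H\to H$ a bialgebra endomorphism, and $M$ a (left-left) Yetter-Drinfeld module over the bialgebra $H$, with action $h\otimes m\mapsto h\cdot m$ and coaction $m\mapsto m_{(-1)}\otimes m_{(0)}$. Let $\alpha_M:M\to M$ be a linear map such that $\alpha_M(h\cdot m)=\alpha_H(h)\cdot\alpha_M(m)$ and $\alpha_M(m)_{(-1)}\otimes\alpha_M(m)_{(0)}=\alpha_H(m_{(-1)})\otimes\alpha_M(m_{(0)})$ for all $h\in H$, $m\in M$. Consider the Hom-bialgebra $H_{\alpha_H}=(H,\alpha_H\circ\mu_H,\Delta_H\circ\alpha_H,\alpha_H)$, and regard $(M,\alpha_M)$ as a left $H_{\alpha_H}$-module with action $h\triangleright m:=\alpha_M(h\cdot m)=\alpha_H(h)\cdot\alpha_M(m)$ and as a left $H_{\alpha_H}$-comodule with coaction $m\mapsto m_{<-1>}\otimes m_{<0>}:=\alpha_M(m)_{(-1)}\otimes\alpha_M(m)_{(0)}=\alpha_H(m_{(-1)})\otimes\alpha_M(m_{(0)})$. Then $(M,\alpha_M)$ with these structures is a Yetter-Drinfeld module over the Hom-bialgebra $H_{\alpha_H}$.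
   Context: Everything is over a field $k$, $\otimes=\otimes_k$; (co)algebras, and hence bialgebras, are not assumed (co)unital, and (co)modules are not assumed (co)unital. Sweedler notation: $\Delta(h)=h_1\otimes h_2$; multiplications are written by juxtaposition. A (left-left) Yetter-Drinfeld module over a bialgebra $H$ is a linear space $M$ that is a left $H$-module and a left $H$-comodule with $(h_1\cdot m)_{(-1)}h_2\otimes(h_1\cdot m)_{(0)}=h_1m_{(-1)}\otimes h_2\cdot m_{(0)}$ for all $h\in H$, $m\in M$. A Hom-bialgebra is $(H,\mu,\Delta,\alpha)$ with $\mu:H\otimes H\to H$, $\Delta:H\to H\otimes H$, $\alpha:H\to H$ linear such that for all $h,h',h''$: $\alpha(hh')=\alpha(h)\alpha(h')$; $\alpha(h)(h'h'')=(hh')\alpha(h'')$; $\Delta(h_1)\otimes\alpha(h_2)=\alpha(h_1)\otimes\Delta(h_2)$; $\Delta(hh')=h_1h'_1\otimes h_2h'_2$; $\Delta(\alpha(h))=\alpha(h_1)\otimes\alpha(h_2)$. Let $(H,\mu_H,\Delta_H,\alpha_H)$ be a Hom-bialgebra, $M$ a linear space, $\alpha_M:M\to M$ linear. $(M,\alpha_M)$ is a left $H$-module if there is a linear map $H\otimes M\to M$, $h\otimes m\mapsto h\cdot m$, with $\alpha_M(h\cdot m)=\alpha_H(h)\cdot\alpha_M(m)$ and $\alpha_H(h)\cdot(h'\cdot m)=(hh')\cdot\alpha_M(m)$. It is a left $H$-comodule if there is a linear map $\lambda:M\to H\otimes M$, $\lambda(m)=m_{(-1)}\otimes m_{(0)}$,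 with $(\alpha_H\otimes\alpha_M)\circ\lambda=\lambda\circ\alpha_M$ and $(\Delta_H\otimes\alpha_M)\circ\lambda=(\alpha_H\otimes\lambda)\circ\lambda$. $(M,\alpha_M)$ is a (left-left) Yetter-Drinfeld module over the Hom-bialgebra $H$ if it is both a left $H$-module and a left $H$-comodule and, for all $h\in H$, $m\in M$, $$(h_1\cdot m)_{(-1)}\alpha_H^2(h_2)\otimes(h_1\cdot m)_{(0)}=\alpha_H^2(h_1)\alpha_H(m_{(-1)})\otimes\alpha_H(h_2)\cdot m_{(0)}.$$ *)

theory Defs
  imports "HOL-Algebra.AbelCoset" "Jordan_Normal_Form.Missing_VectorSpace"
begin

text \<open>
  Vector spaces are those of the locale \<open>vectorspace\<close> (a \<open>module\<close> record over a \<open>field\<close>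
  record), linear maps those of \<open>linear_map\<close>. A \<open>module\<close> record inherits the fields
  \<open>mult\<close> and \<open>one\<close> of a ring; they play no role in a vector space, and the constructions below
  fill them with dummy values.
\<close>


section \<open>Tensor products\<close>

definition free_space :: "('k, 'r) ring_scheme \<Rightarrow> 'x set \<Rightarrow> ('k, 'x \<Rightarrow> 'k) module" where
  "free_space K S =
    \<lparr>carrier = {u. (\<forall>x. u x \<in> carrier K) \<and> (\<forall>x. x \<notin> S \<longrightarrow> u x = \<zero>\<^bsub>K\<^esub>) \<and> finite {x. u x \<noteq> \<zero>\<^bsub>K\<^esub>}},
     mult = (\<lambda>u v x. \<zero>\<^bsub>K\<^esub>), one = (\<lambda>x. \<zero>\<^bsub>K\<^esub>),
     zero = (\<lambda>x. \<zero>\<^bsub>K\<^esub>), add = (\<lambda>u v x. u x \<oplus>\<^bsub>K\<^esub> v x),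
     smult = (\<lambda>c u x. c \<otimes>\<^bsub>K\<^esub> u x)\<rparr>"

definition free_gen :: "('k, 'r) ring_scheme \<Rightarrow> 'x \<Rightarrow> 'x \<Rightarrow> 'k" where
  "free_gen K x = (\<lambda>y. if y = x then \<one>\<^bsub>K\<^esub> else \<zero>\<^bsub>K\<^esub>)"

definition quotient_space :: "('k, 'v, 'm) module_scheme \<Rightarrow> 'v set \<Rightarrow> ('k, 'v set) module" where
  "quotient_space V W =
    \<lparr>carrier = a_rcosets\<^bsub>V\<^esub> W,
     mult = (\<lambda>X Y. W), one = W,
     zero = W, add = (\<lambda>X Y. X <+>\<^bsub>V\<^esub> Y),
     smult = (\<lambda>c X. \<Union>v\<in>X. W +>\<^bsub>V\<^esub> (c \<odot>\<^bsub>V\<^esub> v))\<rparr>"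

definition tensor_relators ::
  "('k, 'r) ring_scheme \<Rightarrow> ('k, 'a, 'm) module_scheme \<Rightarrow> ('k, 'b, 'n) module_scheme
    \<Rightarrow> ('a \<times> 'b \<Rightarrow> 'k) set" where
  "tensor_relators K A B =
    (let F = free_space K (carrier A \<times> carrier B); e = (\<lambda>a b. free_gen K (a, b)) in
      {e (a \<oplus>\<^bsub>A\<^esub> a') b \<ominus>\<^bsub>F\<^esub> (e a b \<oplus>\<^bsub>F\<^esub> e a' b) | a a' b.
          a \<in> carrier A \<and> a' \<in> carrier A \<and> b \<in> carrier B}
      \<union> {e a (b \<oplus>\<^bsub>B\<^esub> b') \<ominus>\<^bsub>F\<^esub> (e a b \<oplus>\<^bsub>F\<^esub> e a b') | a b b'.
          a \<in> carrier A \<and> b \<in> carrier B \<and> b' \<in> carrier B}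
      \<union> {e (c \<odot>\<^bsub>A\<^esub> a) b \<ominus>\<^bsub>F\<^esub> c \<odot>\<^bsub>F\<^esub> e a b | c a b.
          c \<in> carrier K \<and> a \<in> carrier A \<and> b \<in> carrier B}
      \<union> {e a (c \<odot>\<^bsub>B\<^esub> b) \<ominus>\<^bsub>F\<^esub> c \<odot>\<^bsub>F\<^esub> e a b | c a b.
          c \<in> carrier K \<and> a \<in> carrier A \<and> b \<in> carrier B})"

definition tensor_null ::
  "('k, 'r) ring_scheme \<Rightarrow> ('k, 'a, 'm) module_scheme \<Rightarrow> ('k, 'b, 'n) module_scheme
    \<Rightarrow> ('a \<times> 'b \<Rightarrow> 'k) set" where
  "tensor_null K A B =
    LinearCombinations.module.span K (free_space K (carrier A \<times> carrier B)) (tensor_relators K A B)"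

definition tensor_space ::
  "('k, 'r) ring_scheme \<Rightarrow> ('k, 'a, 'm) module_scheme \<Rightarrow> ('k, 'b, 'n) module_scheme
    \<Rightarrow> ('k, ('a \<times> 'b \<Rightarrow> 'k) set) module"  (infixl \<open>\<boxtimes>\<index>\<close> 71) where
  "A \<boxtimes>\<^bsub>K\<^esub> B = quotient_space (free_space K (carrier A \<times> carrier B)) (tensor_null K A B)"

definition pure_tensor ::
  "('k, 'r) ring_scheme \<Rightarrow> ('k, 'a, 'm) module_scheme \<Rightarrow> ('k, 'b, 'n) module_scheme
    \<Rightarrow> 'a \<Rightarrow> 'b \<Rightarrow> ('a \<times> 'b \<Rightarrow> 'k) set" where
  "pure_tensor K A B a b =
    tensor_null K A B +>\<^bsub>free_space K (carrier A \<times> carrier B)\<^esub> free_gen K (a, b)"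

definition bilinear_map ::
  "('k, 'r) ring_scheme \<Rightarrow> ('k, 'a, 'm) module_scheme \<Rightarrow> ('k, 'b, 'n) module_scheme
    \<Rightarrow> ('k, 'c, 'o) module_scheme \<Rightarrow> ('a \<Rightarrow> 'b \<Rightarrow> 'c) \<Rightarrow> bool" where
  "bilinear_map K A B C f \<longleftrightarrow>
    (\<forall>a\<in>carrier A. linear_map K B C (f a)) \<and> (\<forall>b\<in>carrier B. linear_map K A C (\<lambda>a. f a b))"

text \<open>
  For bilinear \<open>f\<close> into \<open>C\<close>, \<open>tensor_lift K C f\<close> is the induced linear map
  on the tensor product: the value on the class of a formal sum \<open>\<Sum> c\<^sub>i (a\<^sub>i, b\<^sub>i)\<close>
  is \<open>\<Sum> c\<^sub>i f a\<^sub>i b\<^sub>i\<close>. Hence \<open>tensor_lift K C (\<lambda>x y. f x y) t\<close> renders the Sweedler-style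
  expression \<open>f t\<^sub>1 t\<^sub>2\<close>.
\<close>

definition tensor_lift ::
  "('k, 'r) ring_scheme \<Rightarrow> ('k, 'c, 'm) module_scheme \<Rightarrow> ('a \<Rightarrow> 'b \<Rightarrow> 'c)
    \<Rightarrow> ('a \<times> 'b \<Rightarrow> 'k) set \<Rightarrow> 'c" where
  "tensor_lift K C f t =
    (THE c. \<forall>u\<in>t. c = (\<Oplus>\<^bsub>C\<^esub>p\<in>{p. u p \<noteq> \<zero>\<^bsub>K\<^esub>}. u p \<odot>\<^bsub>C\<^esub> f (fst p) (snd p)))"

text \<open>
  The construction has the universal property of the tensor product: \<open>pure_tensor K A B\<close> is
  bilinear, and a bilinear map \<open>f\<close> factors through it via the linear map \<open>tensor_lift K C f\<close>.
\<close>

lemma free_space_vectorspace: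
  assumes "field K"
  shows "vectorspace K (free_space K S)"
proof -
  interpret field K by fact
  have fin_add: "finite {x. u x \<oplus>\<^bsub>K\<^esub> v x \<noteq> \<zero>\<^bsub>K\<^esub>}"
    if "finite {x. u x \<noteq> \<zero>\<^bsub>K\<^esub>}" "finite {x. v x \<noteq> \<zero>\<^bsub>K\<^esub>}" for u v
    by (rule finite_subset[OF _ finite_UnI[OF that]]) auto
  have fin_smult: "finite {x. c \<otimes>\<^bsub>K\<^esub> u x \<noteq> \<zero>\<^bsub>K\<^esub>}"
    if "c \<in> carrier K" "finite {x. u x \<noteq> \<zero>\<^bsub>K\<^esub>}" for c u
    by (rule finite_subset[OF _ that(2)]) (use that(1) in auto)
  have neg: "\<exists>v\<in>carrier (free_space K S). u \<oplus>\<^bsub>free_space K S\<^esub> v = \<zero>\<^bsub>free_space K S\<^esub>"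
    if u: "u \<in> carrier (free_space K S)" for u
  proof
    have "{x. \<ominus>\<^bsub>K\<^esub> u x \<noteq> \<zero>\<^bsub>K\<^esub>} \<subseteq> {x. u x \<noteq> \<zero>\<^bsub>K\<^esub>}"
      by auto
    with u show "(\<lambda>x. \<ominus>\<^bsub>K\<^esub> u x) \<in> carrier (free_space K S)"
      by (auto simp: free_space_def intro: finite_subset)
    show "u \<oplus>\<^bsub>free_space K S\<^esub> (\<lambda>x. \<ominus>\<^bsub>K\<^esub> u x) = \<zero>\<^bsub>free_space K S\<^esub>"
      using u by (auto simp: free_space_def r_neg)
  qed
  show ?thesis
    apply (rule vs_criteria)
               apply (rule assms)
              apply (simp add: free_space_def)
             apply (simp add: free_space_def fin_add)
            apply (use neg in blast)
           apply (simp add: free_space_def fin_smult)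
          apply (auto simp: free_space_def a_comm)[1]
         apply (auto simp: free_space_def a_assoc)[1]
        apply (auto simp: free_space_def)[1]
       apply (auto simp: free_space_def m_assoc)[1]
      apply (auto simp: free_space_def)[1]
     apply (auto simp: free_space_def l_distr)[1]
    apply (auto simp: free_space_def r_distr)[1]
    done
qed

lemma free_gen_closed:
  assumes "field K" "x \<in> S"
  shows "free_gen K x \<in> carrier (free_space K S)"
proof -
  interpret field K by fact
  show ?thesis using assms(2) by (auto simp: free_space_def free_gen_def)
qed

lemma submodule_subgroup:
  assumes "submodule K W V"
  shows "subgroup W (add_monoid V)"
proof -
  interpret W: submodule K W V by fact
  interpret V: module K V by (fact W.module)
  show ?thesis
  proof (rule V.add.subgroupI)
    fix w assume w: "w \<in> W"
    hence "(\<ominus>\<^bsub>K\<^esub> \<one>\<^bsub>K\<^esub>) \<odot>\<^bsub>V\<^esub> w \<in> W" by simp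
    moreover have "(\<ominus>\<^bsub>K\<^esub> \<one>\<^bsub>K\<^esub>) \<odot>\<^bsub>V\<^esub> w = \<ominus>\<^bsub>V\<^esub> w"
      using w W.subset by (intro V.smult_minus_1) auto
    ultimately show "\<ominus>\<^bsub>V\<^esub> w \<in> W" by simp
  next
    show "W \<noteq> {}" using W.zero_closed by (metis empty_iff)
  qed (use W.subset in auto)
qed

lemma quotient_space:
  assumes V: "vectorspace K V" and W: "submodule K W V"
  shows quotient_space_vectorspace: "vectorspace K (quotient_space V W)"
    and quotient_space_proj: "linear_map K V (quotient_space V W) (\<lambda>v. W +>\<^bsub>V\<^esub> v)"
proof -
  interpret V: vectorspace K V by fact
  interpret W: submodule K W V by fact
  have sub: "subgroup W (add_monoid V)" by (rule submodule_subgroup[OF W])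
  interpret Q: abelian_subgroup W V
    by (intro abelian_subgroupI3 additive_subgroup.intro sub V.M.abelian_group_axioms)
  have car: "carrier (quotient_space V W) = (\<lambda>v. W +>\<^bsub>V\<^esub> v) ` carrier V"
    by (auto simp: quotient_space_def A_RCOSETS_def')
  have add: "(W +>\<^bsub>V\<^esub> v) \<oplus>\<^bsub>quotient_space V W\<^esub> (W +>\<^bsub>V\<^esub> w) = W +>\<^bsub>V\<^esub> (v \<oplus>\<^bsub>V\<^esub> w)"
    if "v \<in> carrier V" "w \<in> carrier V" for v w
    using that by (simp add: quotient_space_def Q.a_rcos_sum)
  have zero: "\<zero>\<^bsub>quotient_space V W\<^esub> = W +>\<^bsub>V\<^esub> \<zero>\<^bsub>V\<^esub>"
    using W.subset by (simp add: quotient_space_def)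
  have smult: "c \<odot>\<^bsub>quotient_space V W\<^esub> (W +>\<^bsub>V\<^esub> v) = W +>\<^bsub>V\<^esub> (c \<odot>\<^bsub>V\<^esub> v)"
    if c: "c \<in> carrier K" and v: "v \<in> carrier V" for c v
  proof -
    have const: "W +>\<^bsub>V\<^esub> (c \<odot>\<^bsub>V\<^esub> w) = W +>\<^bsub>V\<^esub> (c \<odot>\<^bsub>V\<^esub> v)" if w: "w \<in> W +>\<^bsub>V\<^esub> v" for w
    proof -
      from w obtain h where h: "h \<in> W" "w = h \<oplus>\<^bsub>V\<^esub> v"
        by (auto simp: a_r_coset_def')
      hence "c \<odot>\<^bsub>V\<^esub> w = c \<odot>\<^bsub>V\<^esub> h \<oplus>\<^bsub>V\<^esub> c \<odot>\<^bsub>V\<^esub> v"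
        using c v W.subset by (auto simp: V.smult_r_distr)
      moreover have "c \<odot>\<^bsub>V\<^esub> h \<in> W" using c h by simp
      ultimately have "c \<odot>\<^bsub>V\<^esub> w \<in> W +>\<^bsub>V\<^esub> (c \<odot>\<^bsub>V\<^esub> v)"
        by (auto simp: a_r_coset_def')
      thus ?thesis using V.M.a_repr_independence[OF _ _ sub] c v by auto
    qed
    have "v \<in> W +>\<^bsub>V\<^esub> v" using v by (rule Q.a_rcos_self)
    hence "(\<Union>w\<in>W +>\<^bsub>V\<^esub> v. W +>\<^bsub>V\<^esub> (c \<odot>\<^bsub>V\<^esub> w)) = W +>\<^bsub>V\<^esub> (c \<odot>\<^bsub>V\<^esub> v)"
      by (rule UN_constant_eq) (intro ballI const)
    thus ?thesis by (simp add: quotient_space_def)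
  qed
  show vs: "vectorspace K (quotient_space V W)"
  proof (rule vs_criteria)
    show "field K" ..
    have "\<exists>w\<in>carrier V. W +>\<^bsub>V\<^esub> (v \<oplus>\<^bsub>V\<^esub> w) = W +>\<^bsub>V\<^esub> \<zero>\<^bsub>V\<^esub>" if "v \<in> carrier V" for v
      using that by (intro bexI[of _ "\<ominus>\<^bsub>V\<^esub> v"]) (simp_all add: V.M.r_neg)
    thus "\<forall>X\<in>carrier (quotient_space V W). \<exists>Y\<in>carrier (quotient_space V W).
        X \<oplus>\<^bsub>quotient_space V W\<^esub> Y = \<zero>\<^bsub>quotient_space V W\<^esub>"
      by (auto simp: car add zero)
  qed (auto simp: car add zero smult V.M.a_ac V.smult_assoc1 V.smult_l_distr V.smult_r_distr)
  interpret Q: vectorspace K "quotient_space V W" by (fact vs)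
  show "linear_map K V (quotient_space V W) (\<lambda>v. W +>\<^bsub>V\<^esub> v)"
    by unfold_locales (auto simp: module_hom_def car add smult)
qed

lemma tensor_relatorsI:
  fixes A :: "('k, 'a, 'm) module_scheme" and B :: "('k, 'b, 'n) module_scheme"
    and K :: "('k, 'r) ring_scheme"
  defines "F \<equiv> free_space K (carrier A \<times> carrier B)"
  assumes "a \<in> carrier A" "b \<in> carrier B"
  shows "a' \<in> carrier A \<Longrightarrow>
      free_gen K (a \<oplus>\<^bsub>A\<^esub> a', b) \<ominus>\<^bsub>F\<^esub> (free_gen K (a, b) \<oplus>\<^bsub>F\<^esub> free_gen K (a', b)) \<in> tensor_relators K A B"
    and "b' \<in> carrier B \<Longrightarrow>
      free_gen K (a, b \<oplus>\<^bsub>B\<^esub> b') \<ominus>\<^bsub>F\<^esub> (free_gen K (a, b) \<oplus>\<^bsub>F\<^esub> free_gen K (a, b')) \<in> tensor_relators K A B"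
    and "c \<in> carrier K \<Longrightarrow>
      free_gen K (c \<odot>\<^bsub>A\<^esub> a, b) \<ominus>\<^bsub>F\<^esub> c \<odot>\<^bsub>F\<^esub> free_gen K (a, b) \<in> tensor_relators K A B"
    and "c \<in> carrier K \<Longrightarrow>
      free_gen K (a, c \<odot>\<^bsub>B\<^esub> b) \<ominus>\<^bsub>F\<^esub> c \<odot>\<^bsub>F\<^esub> free_gen K (a, b) \<in> tensor_relators K A B"
  using assms(2,3) unfolding tensor_relators_def Let_def F_def by blast+

lemma tensor_null_submodule:
  assumes A: "vectorspace K A" and B: "vectorspace K B"
  shows "submodule K (tensor_null K A B) (free_space K (carrier A \<times> carrier B))"
    and "tensor_relators K A B \<subseteq> tensor_null K A B"
proof -
  interpret A: vectorspace K A by fact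
  interpret B: vectorspace K B by fact
  interpret F: vectorspace K "free_space K (carrier A \<times> carrier B)"
    by (rule free_space_vectorspace) (fact A.field_axioms)
  have gen: "free_gen K (a, b) \<in> carrier (free_space K (carrier A \<times> carrier B))"
    if "a \<in> carrier A" "b \<in> carrier B" for a b
    using that by (intro free_gen_closed A.field_axioms) auto
  have sub: "tensor_relators K A B \<subseteq> carrier (free_space K (carrier A \<times> carrier B))"
    by (auto simp: tensor_relators_def Let_def
        intro!: F.M.minus_closed F.M.a_closed F.smult_closed gen)
  show "submodule K (tensor_null K A B) (free_space K (carrier A \<times> carrier B))"
    unfolding tensor_null_def by (rule F.span_is_submodule[OF sub])
  show "tensor_relators K A B \<subseteq> tensor_null K A B"
    unfolding tensor_null_def by (rule F.in_own_span[OF sub])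
qed

lemma tensor_space_vectorspace:
  assumes "vectorspace K A" "vectorspace K B"
  shows "vectorspace K (A \<boxtimes>\<^bsub>K\<^esub> B)"
proof -
  interpret A: vectorspace K A by fact
  show ?thesis unfolding tensor_space_def
    by (intro quotient_space_vectorspace free_space_vectorspace tensor_null_submodule
        A.field_axioms assms)
qed

lemma pure_tensor_bilinear:
  assumes A: "vectorspace K A" and B: "vectorspace K B"
  shows "bilinear_map K A B (A \<boxtimes>\<^bsub>K\<^esub> B) (pure_tensor K A B)"
proof -
  interpret A: vectorspace K A by fact
  interpret B: vectorspace K B by fact
  let ?F = "free_space K (carrier A \<times> carrier B)"
  let ?N = "tensor_null K A B"
  let ?e = "\<lambda>a b. free_gen K (a, b)"
  interpret F: vectorspace K ?F by (rule free_space_vectorspace) (fact A.field_axioms)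
  interpret T: vectorspace K "A \<boxtimes>\<^bsub>K\<^esub> B" by (rule tensor_space_vectorspace[OF A B])
  interpret N: submodule K ?N ?F by (rule tensor_null_submodule(1)[OF A B])
  interpret p: linear_map K ?F "A \<boxtimes>\<^bsub>K\<^esub> B" "\<lambda>u. ?N +>\<^bsub>?F\<^esub> u"
    unfolding tensor_space_def
    by (rule quotient_space_proj[OF F.vectorspace_axioms N.submodule_axioms])
  have gen: "?e a b \<in> carrier ?F" if "a \<in> carrier A" "b \<in> carrier B" for a b
    using that by (intro free_gen_closed A.field_axioms) auto
  have eq: "?N +>\<^bsub>?F\<^esub> u = ?N +>\<^bsub>?F\<^esub> v"
    if r: "u \<ominus>\<^bsub>?F\<^esub> v \<in> tensor_relators K A B" and uv: "u \<in> carrier ?F" "v \<in> carrier ?F" for u v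
  proof -
    have "u \<ominus>\<^bsub>?F\<^esub> v \<in> ?N" using r tensor_null_submodule(2)[OF A B] by blast
    moreover have "u = (u \<ominus>\<^bsub>?F\<^esub> v) \<oplus>\<^bsub>?F\<^esub> v"
      using uv by (simp add: a_minus_def F.M.a_assoc F.M.l_neg)
    ultimately have "u \<in> ?N +>\<^bsub>?F\<^esub> v" by (auto simp: a_r_coset_def')
    moreover have "subgroup ?N (add_monoid ?F)"
      by (rule submodule_subgroup[OF N.submodule_axioms])
    ultimately show ?thesis using F.M.a_repr_independence[OF _ uv(2)] by simp
  qed
  have "pure_tensor K A B (a \<oplus>\<^bsub>A\<^esub> a') b
      = pure_tensor K A B a b \<oplus>\<^bsub>A \<boxtimes>\<^bsub>K\<^esub> B\<^esub> pure_tensor K A B a' b"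
    if "a \<in> carrier A" "a' \<in> carrier A" "b \<in> carrier B" for a a' b
    unfolding pure_tensor_def p.T_add[OF gen[OF that(1,3)] gen[OF that(2,3)], symmetric]
    by (intro eq tensor_relatorsI gen F.M.a_closed A.M.a_closed that)
  moreover have "pure_tensor K A B a (b \<oplus>\<^bsub>B\<^esub> b')
      = pure_tensor K A B a b \<oplus>\<^bsub>A \<boxtimes>\<^bsub>K\<^esub> B\<^esub> pure_tensor K A B a b'"
    if "a \<in> carrier A" "b \<in> carrier B" "b' \<in> carrier B" for a b b'
    unfolding pure_tensor_def p.T_add[OF gen[OF that(1,2)] gen[OF that(1,3)], symmetric]
    by (intro eq tensor_relatorsI gen F.M.a_closed B.M.a_closed that)
  moreover have "pure_tensor K A B (c \<odot>\<^bsub>A\<^esub> a) b = c \<odot>\<^bsub>A \<boxtimes>\<^bsub>K\<^esub> B\<^esub> pure_tensor K A B a b"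
    if "c \<in> carrier K" "a \<in> carrier A" "b \<in> carrier B" for c a b
    unfolding pure_tensor_def p.T_smult[OF that(1) gen[OF that(2,3)], symmetric]
    by (intro eq tensor_relatorsI gen F.smult_closed A.smult_closed that)
  moreover have "pure_tensor K A B a (c \<odot>\<^bsub>B\<^esub> b) = c \<odot>\<^bsub>A \<boxtimes>\<^bsub>K\<^esub> B\<^esub> pure_tensor K A B a b"
    if "c \<in> carrier K" "a \<in> carrier A" "b \<in> carrier B" for c a b
    unfolding pure_tensor_def p.T_smult[OF that(1) gen[OF that(2,3)], symmetric]
    by (intro eq tensor_relatorsI gen F.smult_closed B.smult_closed that)
  moreover have "pure_tensor K A B a b \<in> carrier (A \<boxtimes>\<^bsub>K\<^esub> B)"
    if "a \<in> carrier A" "b \<in> carrier B" for a b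
    unfolding pure_tensor_def by (rule p.T_im[OF gen[OF that]])
  ultimately show ?thesis
    unfolding bilinear_map_def
    by (auto intro!: linear_map.intro mod_hom.intro mod_hom_axioms.intro
        simp: module_hom_def A.vectorspace_axioms B.vectorspace_axioms T.vectorspace_axioms
          A.module_axioms B.module_axioms T.module_axioms)
qed

lemma tensor_lift:
  assumes A: "vectorspace K A" and B: "vectorspace K B" and C: "vectorspace K C"
    and f: "bilinear_map K A B C f"
  shows tensor_lift_linear: "linear_map K (A \<boxtimes>\<^bsub>K\<^esub> B) C (tensor_lift K C f)"
    and tensor_lift_pure: "\<And>a b. \<lbrakk>a \<in> carrier A; b \<in> carrier B\<rbrakk> \<Longrightarrow>
      tensor_lift K C f (pure_tensor K A B a b) = f a b"
proof -
  interpret A: vectorspace K A by fact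
  interpret B: vectorspace K B by fact
  interpret C: vectorspace K C by fact
  let ?F = "free_space K (carrier A \<times> carrier B)"
  let ?N = "tensor_null K A B"
  let ?e = "\<lambda>a b. free_gen K (a, b)"
  let ?ev = "\<lambda>u. \<Oplus>\<^bsub>C\<^esub>p\<in>{p. u p \<noteq> \<zero>\<^bsub>K\<^esub>}. u p \<odot>\<^bsub>C\<^esub> f (fst p) (snd p)"
  interpret F: vectorspace K ?F by (rule free_space_vectorspace) (fact A.field_axioms)
  interpret T: vectorspace K "A \<boxtimes>\<^bsub>K\<^esub> B" by (rule tensor_space_vectorspace[OF A B])
  interpret N: submodule K ?N ?F by (rule tensor_null_submodule(1)[OF A B])
  interpret p: linear_map K ?F "A \<boxtimes>\<^bsub>K\<^esub> B" "\<lambda>u. ?N +>\<^bsub>?F\<^esub> u"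
    unfolding tensor_space_def
    by (rule quotient_space_proj[OF F.vectorspace_axioms N.submodule_axioms])
  have gen: "?e a b \<in> carrier ?F" if "a \<in> carrier A" "b \<in> carrier B" for a b
    using that by (intro free_gen_closed A.field_axioms) auto
  have f1: "linear_map K B C (f a)" if "a \<in> carrier A" for a
    using f that by (auto simp: bilinear_map_def)
  have f2: "linear_map K A C (\<lambda>a. f a b)" if "b \<in> carrier B" for b
    using f that by (auto simp: bilinear_map_def)
  have f_im: "f a b \<in> carrier C" if "a \<in> carrier A" "b \<in> carrier B" for a b
    using linear_map.T_im[OF f1] that by auto
  have in_F: "finite {p. u p \<noteq> \<zero>\<^bsub>K\<^esub>}" "{p. u p \<noteq> \<zero>\<^bsub>K\<^esub>} \<subseteq> carrier A \<times> carrier B" "u p \<in> carrier K"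
    if "u \<in> carrier ?F" for u p
  proof -
    have u: "\<forall>p. u p \<in> carrier K" "\<forall>p. p \<notin> carrier A \<times> carrier B \<longrightarrow> u p = \<zero>\<^bsub>K\<^esub>" "finite {p. u p \<noteq> \<zero>\<^bsub>K\<^esub>}"
      using that by (simp_all add: free_space_def)
    thus "finite {p. u p \<noteq> \<zero>\<^bsub>K\<^esub>}" "{p. u p \<noteq> \<zero>\<^bsub>K\<^esub>} \<subseteq> carrier A \<times> carrier B" "u p \<in> carrier K"
      by blast+
  qed
  have summand: "u p \<odot>\<^bsub>C\<^esub> f (fst p) (snd p) \<in> carrier C" 
    if "u \<in> carrier ?F" "p \<in> carrier A \<times> carrier B" for u p
    using in_F(3)[OF that(1)] that(2) f_im by auto
  have extend: "?ev u = (\<Oplus>\<^bsub>C\<^esub>p\<in>P. u p \<odot>\<^bsub>C\<^esub> f (fst p) (snd p))"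
    if u: "u \<in> carrier ?F" and P: "finite P" "{p. u p \<noteq> \<zero>\<^bsub>K\<^esub>} \<subseteq> P" "P \<subseteq> carrier A \<times> carrier B" for u P
    by (rule C.add.finprod_mono_neutral_cong_left)
      (use P summand[OF u] f_im in \<open>auto simp: C.smult_l_null\<close>)
  have ev_im: "?ev u \<in> carrier C" if "u \<in> carrier ?F" for u
    by (rule C.M.finsum_closed) (use in_F[OF that] summand[OF that] in auto)
  have ev_add: "?ev (u \<oplus>\<^bsub>?F\<^esub> v) = ?ev u \<oplus>\<^bsub>C\<^esub> ?ev v" if uv: "u \<in> carrier ?F" "v \<in> carrier ?F" for u v
  proof -
    let ?P = "{p. u p \<noteq> \<zero>\<^bsub>K\<^esub>} \<union> {p. v p \<noteq> \<zero>\<^bsub>K\<^esub>}"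
    have P: "finite ?P" "?P \<subseteq> carrier A \<times> carrier B" using in_F uv by auto
    have app: "(u \<oplus>\<^bsub>?F\<^esub> v) p = u p \<oplus>\<^bsub>K\<^esub> v p" for p by (simp add: free_space_def)
    have "?ev (u \<oplus>\<^bsub>?F\<^esub> v) = (\<Oplus>\<^bsub>C\<^esub>p\<in>?P. (u \<oplus>\<^bsub>?F\<^esub> v) p \<odot>\<^bsub>C\<^esub> f (fst p) (snd p))"
      by (rule extend[OF F.M.a_closed[OF uv]]) (use in_F uv P in \<open>auto simp: app\<close>)
    also have "\<dots> = (\<Oplus>\<^bsub>C\<^esub>p\<in>?P. u p \<odot>\<^bsub>C\<^esub> f (fst p) (snd p) \<oplus>\<^bsub>C\<^esub> v p \<odot>\<^bsub>C\<^esub> f (fst p) (snd p))"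
      by (rule C.M.finsum_cong') (use P summand uv app in_F(3) f_im in \<open>auto simp: C.smult_l_distr\<close>)
    also have "\<dots> = (\<Oplus>\<^bsub>C\<^esub>p\<in>?P. u p \<odot>\<^bsub>C\<^esub> f (fst p) (snd p)) \<oplus>\<^bsub>C\<^esub> (\<Oplus>\<^bsub>C\<^esub>p\<in>?P. v p \<odot>\<^bsub>C\<^esub> f (fst p) (snd p))"
      by (rule C.M.finsum_addf) (use P summand uv in auto)
    also have "(\<Oplus>\<^bsub>C\<^esub>p\<in>?P. u p \<odot>\<^bsub>C\<^esub> f (fst p) (snd p)) = ?ev u"
      by (rule extend[symmetric]) (use uv P in auto)
    also have "(\<Oplus>\<^bsub>C\<^esub>p\<in>?P. v p \<odot>\<^bsub>C\<^esub> f (fst p) (snd p)) = ?ev v"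
      by (rule extend[symmetric]) (use uv P in auto)
    finally show ?thesis .
  qed
  have ev_smult: "?ev (c \<odot>\<^bsub>?F\<^esub> u) = c \<odot>\<^bsub>C\<^esub> ?ev u" if c: "c \<in> carrier K" and u: "u \<in> carrier ?F" for c u
  proof -
    have app: "(c \<odot>\<^bsub>?F\<^esub> u) p = c \<otimes>\<^bsub>K\<^esub> u p" for p by (simp add: free_space_def)
    have "?ev (c \<odot>\<^bsub>?F\<^esub> u) = (\<Oplus>\<^bsub>C\<^esub>p\<in>{p. u p \<noteq> \<zero>\<^bsub>K\<^esub>}. (c \<odot>\<^bsub>?F\<^esub> u) p \<odot>\<^bsub>C\<^esub> f (fst p) (snd p))"
      by (rule extend[OF F.smult_closed[OF c u]]) (use c in_F[OF u] in \<open>auto simp: app\<close>)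
    also have "\<dots> = (\<Oplus>\<^bsub>C\<^esub>p\<in>{p. u p \<noteq> \<zero>\<^bsub>K\<^esub>}. c \<odot>\<^bsub>C\<^esub> (u p \<odot>\<^bsub>C\<^esub> f (fst p) (snd p)))"
      by (rule C.M.finsum_cong')
        (use c in_F[OF u] summand[OF u] f_im in \<open>auto simp: app C.smult_assoc1\<close>)
    also have "\<dots> = c \<odot>\<^bsub>C\<^esub> ?ev u"
      by (rule C.finsum_smult_ldistr[symmetric])
        (use c in_F[OF u] summand[OF u] in auto)
    finally show ?thesis .
  qed
  interpret ev: linear_map K ?F C ?ev
    by unfold_locales (auto simp: module_hom_def ev_im ev_add ev_smult)
  have ev_gen: "?ev (?e a b) = f a b" if ab: "a \<in> carrier A" "b \<in> carrier B" for a b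
  proof -
    have "?ev (?e a b) = (\<Oplus>\<^bsub>C\<^esub>p\<in>{(a, b)}. ?e a b p \<odot>\<^bsub>C\<^esub> f (fst p) (snd p))"
      by (rule extend) (use gen[OF ab] ab in \<open>auto simp: free_gen_def\<close>)
    also have "\<dots> = f a b" using f_im[OF ab] by (simp add: free_gen_def)
    finally show ?thesis .
  qed
  have kerI: "u \<ominus>\<^bsub>?F\<^esub> v \<in> ev.ker"
    if uv: "u \<in> carrier ?F" "v \<in> carrier ?F" and eq: "?ev u = ?ev v" for u v
  proof -
    have "?ev (u \<ominus>\<^bsub>?F\<^esub> v) = ?ev u \<ominus>\<^bsub>C\<^esub> ?ev v" by (rule ev.T_minus[OF uv])
    also have "\<dots> = \<zero>\<^bsub>C\<^esub>" unfolding eq a_minus_def by (rule C.M.r_neg[OF ev_im[OF uv(2)]])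
    finally show ?thesis using F.M.minus_closed[OF uv] unfolding ev.ker_def by blast
  qed
  have r1: "?e (a \<oplus>\<^bsub>A\<^esub> a') b \<ominus>\<^bsub>?F\<^esub> (?e a b \<oplus>\<^bsub>?F\<^esub> ?e a' b) \<in> ev.ker"
    if "a \<in> carrier A" "a' \<in> carrier A" "b \<in> carrier B" for a a' b
    by (rule kerI)
      (use that linear_map.T_add[OF f2, of b a a'] in
        \<open>simp_all only: ev_gen ev_add gen A.M.a_closed F.M.a_closed\<close>)
  have r2: "?e a (b \<oplus>\<^bsub>B\<^esub> b') \<ominus>\<^bsub>?F\<^esub> (?e a b \<oplus>\<^bsub>?F\<^esub> ?e a b') \<in> ev.ker"
    if "a \<in> carrier A" "b \<in> carrier B" "b' \<in> carrier B" for a b b'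
    by (rule kerI)
      (use that linear_map.T_add[OF f1, of a b b'] in
        \<open>simp_all only: ev_gen ev_add gen B.M.a_closed F.M.a_closed\<close>)
  have r3: "?e (c \<odot>\<^bsub>A\<^esub> a) b \<ominus>\<^bsub>?F\<^esub> c \<odot>\<^bsub>?F\<^esub> ?e a b \<in> ev.ker"
    if "c \<in> carrier K" "a \<in> carrier A" "b \<in> carrier B" for c a b
    by (rule kerI)
      (use that linear_map.T_smult[OF f2, of b c a] in
        \<open>simp_all only: ev_gen ev_smult gen A.smult_closed F.smult_closed\<close>)
  have r4: "?e a (c \<odot>\<^bsub>B\<^esub> b) \<ominus>\<^bsub>?F\<^esub> c \<odot>\<^bsub>?F\<^esub> ?e a b \<in> ev.ker"
    if "c \<in> carrier K" "a \<in> carrier A" "b \<in> carrier B" for c a b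
    by (rule kerI)
      (use that linear_map.T_smult[OF f1, of a c b] in
        \<open>simp_all only: ev_gen ev_smult gen B.smult_closed F.smult_closed\<close>)
  have "tensor_relators K A B \<subseteq> ev.ker"
    unfolding tensor_relators_def Let_def
    by (intro Un_least subsetI; elim CollectE exE conjE; hypsubst)
      (rule r1 r2 r3 r4; assumption)+
  hence null: "?N \<subseteq> ev.ker"
    unfolding tensor_null_def by (rule F.span_is_subset) (rule ev.ker_is_submodule)
  have coset: "?ev u' = ?ev u" if u: "u \<in> carrier ?F" and u': "u' \<in> ?N +>\<^bsub>?F\<^esub> u" for u u'
  proof -
    from u' obtain n where n: "n \<in> ?N" "u' = n \<oplus>\<^bsub>?F\<^esub> u" by (auto simp: a_r_coset_def')
    moreover have "n \<in> carrier ?F" "?ev n = \<zero>\<^bsub>C\<^esub>" using n(1) null by (auto simp: ev.ker_def)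
    ultimately show ?thesis using ev_add[of n u] u ev_im[OF u] by simp
  qed
  have self: "u \<in> ?N +>\<^bsub>?F\<^esub> u" if u: "u \<in> carrier ?F" for u
  proof -
    have "\<zero>\<^bsub>?F\<^esub> \<oplus>\<^bsub>?F\<^esub> u \<in> ?N +>\<^bsub>?F\<^esub> u"
      unfolding a_r_coset_def' using N.zero_closed by blast
    thus ?thesis by (simp only: F.M.l_zero[OF u])
  qed
  have lift: "tensor_lift K C f (?N +>\<^bsub>?F\<^esub> u) = ?ev u" if u: "u \<in> carrier ?F" for u
    unfolding tensor_lift_def
  proof (rule the_equality)
    show "\<forall>u'\<in>?N +>\<^bsub>?F\<^esub> u. ?ev u = ?ev u'"
      by (intro ballI coset[OF u, symmetric])
    show "c = ?ev u" if "\<forall>u'\<in>?N +>\<^bsub>?F\<^esub> u. c = ?ev u'" for c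
      using bspec[OF that self[OF u]] .
  qed
  show "tensor_lift K C f (pure_tensor K A B a b) = f a b"
    if "a \<in> carrier A" "b \<in> carrier B" for a b
    unfolding pure_tensor_def lift[OF gen[OF that]] by (rule ev_gen[OF that])
  have car: "\<exists>u\<in>carrier ?F. t = ?N +>\<^bsub>?F\<^esub> u" if "t \<in> carrier (A \<boxtimes>\<^bsub>K\<^esub> B)" for t
    using that by (auto simp: tensor_space_def quotient_space_def A_RCOSETS_def')
  show "linear_map K (A \<boxtimes>\<^bsub>K\<^esub> B) C (tensor_lift K C f)"
  proof (unfold_locales, unfold module_hom_def, intro CollectI conjI funcsetI allI impI; (elim conjE)?)
    fix t assume t: "t \<in> carrier (A \<boxtimes>\<^bsub>K\<^esub> B)"
    obtain u where u: "u \<in> carrier ?F" "t = ?N +>\<^bsub>?F\<^esub> u" by (rule bexE[OF car[OF t]])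
    show "tensor_lift K C f t \<in> carrier C"
      unfolding u(2) lift[OF u(1)] by (rule ev_im[OF u(1)])
  next
    fix t t' assume t: "t \<in> carrier (A \<boxtimes>\<^bsub>K\<^esub> B)" "t' \<in> carrier (A \<boxtimes>\<^bsub>K\<^esub> B)"
    obtain u where u1: "u \<in> carrier ?F" "t = ?N +>\<^bsub>?F\<^esub> u" by (rule bexE[OF car[OF t(1)]])
    obtain u' where u2: "u' \<in> carrier ?F" "t' = ?N +>\<^bsub>?F\<^esub> u'" by (rule bexE[OF car[OF t(2)]])
    note u = u1 u2
    have "t \<oplus>\<^bsub>A \<boxtimes>\<^bsub>K\<^esub> B\<^esub> t' = ?N +>\<^bsub>?F\<^esub> (u \<oplus>\<^bsub>?F\<^esub> u')"
      unfolding u(2,4) by (rule p.T_add[OF u(1,3), symmetric])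
    thus "tensor_lift K C f (t \<oplus>\<^bsub>A \<boxtimes>\<^bsub>K\<^esub> B\<^esub> t') = tensor_lift K C f t \<oplus>\<^bsub>C\<^esub> tensor_lift K C f t'"
      by (simp only: u(2,4) lift[OF u(1)] lift[OF u(3)] lift[OF F.M.a_closed[OF u(1,3)]] ev_add[OF u(1,3)])
  next
    fix c t assume c: "c \<in> carrier K" and t: "t \<in> carrier (A \<boxtimes>\<^bsub>K\<^esub> B)"
    obtain u where u: "u \<in> carrier ?F" "t = ?N +>\<^bsub>?F\<^esub> u" by (rule bexE[OF car[OF t]])
    have "c \<odot>\<^bsub>A \<boxtimes>\<^bsub>K\<^esub> B\<^esub> t = ?N +>\<^bsub>?F\<^esub> (c \<odot>\<^bsub>?F\<^esub> u)"
      unfolding u(2) by (rule p.T_smult[OF c u(1), symmetric])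
    thus "tensor_lift K C f (c \<odot>\<^bsub>A \<boxtimes>\<^bsub>K\<^esub> B\<^esub> t) = c \<odot>\<^bsub>C\<^esub> tensor_lift K C f t"
      by (simp only: u(2) lift[OF u(1)] lift[OF F.smult_closed[OF c u(1)]] ev_smult[OF c u(1)])
  qed
qed

text \<open>\<open>tensor_map K C D f g\<close> is \<open>f \<otimes> g\<close>, where \<open>C\<close> and \<open>D\<close> are the codomains of \<open>f\<close> and \<open>g\<close>.\<close>

definition tensor_map ::
  "('k, 'r) ring_scheme \<Rightarrow> ('k, 'c, 'm) module_scheme \<Rightarrow> ('k, 'd, 'n) module_scheme
    \<Rightarrow> ('a \<Rightarrow> 'c) \<Rightarrow> ('b \<Rightarrow> 'd) \<Rightarrow> ('a \<times> 'b \<Rightarrow> 'k) set \<Rightarrow> ('c \<times> 'd \<Rightarrow> 'k) set" where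
  "tensor_map K C D f g = tensor_lift K (C \<boxtimes>\<^bsub>K\<^esub> D) (\<lambda>a b. pure_tensor K C D (f a) (g b))"

text \<open>The associator \<open>(A \<otimes> B) \<otimes> C \<rightarrow> A \<otimes> (B \<otimes> C)\<close>, left implicit on paper.\<close>

definition tensor_assoc ::
  "('k, 'r) ring_scheme \<Rightarrow> ('k, 'a, 'm) module_scheme \<Rightarrow> ('k, 'b, 'n) module_scheme
    \<Rightarrow> ('k, 'c, 'o) module_scheme
    \<Rightarrow> (('a \<times> 'b \<Rightarrow> 'k) set \<times> 'c \<Rightarrow> 'k) set \<Rightarrow> ('a \<times> ('b \<times> 'c \<Rightarrow> 'k) set \<Rightarrow> 'k) set" where
  "tensor_assoc K A B C =
    tensor_lift K (A \<boxtimes>\<^bsub>K\<^esub> (B \<boxtimes>\<^bsub>K\<^esub> C)) (\<lambda>t c.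
      tensor_lift K (A \<boxtimes>\<^bsub>K\<^esub> (B \<boxtimes>\<^bsub>K\<^esub> C)) (\<lambda>a b.
        pure_tensor K A (B \<boxtimes>\<^bsub>K\<^esub> C) a (pure_tensor K B C b c)) t)"

section \<open>Bialgebras and Yetter-Drinfeld modules\<close>

text \<open>
  No units or counits are required. Multiplications and actions, as linear maps out of a tensor
  product, are given by the corresponding bilinear maps.
\<close>

locale bialgebra =
  fixes K (structure) and H and \<mu> and \<Delta>
  assumes vectorspace: "vectorspace K H"
    and \<mu>_bilinear: "bilinear_map K H H H \<mu>"
    and \<Delta>_linear: "linear_map K H (H \<boxtimes> H) \<Delta>"
    and assoc: "\<lbrakk>x \<in> carrier H; y \<in> carrier H; z \<in> carrier H\<rbrakk> \<Longrightarrow> \<mu> x (\<mu> y z) = \<mu> (\<mu> x y) z"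
    and coassoc: "x \<in> carrier H \<Longrightarrow>
      tensor_assoc K H H H (tensor_map K (H \<boxtimes> H) H \<Delta> (\<lambda>y. y) (\<Delta> x))
        = tensor_map K H (H \<boxtimes> H) (\<lambda>y. y) \<Delta> (\<Delta> x)"
    and \<Delta>_mult: "\<lbrakk>x \<in> carrier H; y \<in> carrier H\<rbrakk> \<Longrightarrow>
      \<Delta> (\<mu> x y)
        = tensor_lift K (H \<boxtimes> H) (\<lambda>x1 x2.
            tensor_lift K (H \<boxtimes> H) (\<lambda>y1 y2. pure_tensor K H H (\<mu> x1 y1) (\<mu> x2 y2)) (\<Delta> y)) (\<Delta> x)"

locale bialgebra_endomorphism = bialgebra +
  fixes \<alpha>
  assumes \<alpha>_linear: "linear_map K H H \<alpha>"
    and \<alpha>_mult: "\<lbrakk>x \<in> carrier H; y \<in> carrier H\<rbrakk> \<Longrightarrow> \<alpha> (\<mu> x y) = \<mu> (\<alpha> x) (\<alpha> y)"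
    and \<alpha>_comult: "x \<in> carrier H \<Longrightarrow> \<Delta> (\<alpha> x) = tensor_map K H H \<alpha> \<alpha> (\<Delta> x)"

locale bialgebra_left_module = bialgebra +
  fixes M and act
  assumes M_vectorspace: "vectorspace K M"
    and act_bilinear: "bilinear_map K H M M act"
    and act_assoc: "\<lbrakk>x \<in> carrier H; y \<in> carrier H; m \<in> carrier M\<rbrakk> \<Longrightarrow>
      act x (act y m) = act (\<mu> x y) m"

locale bialgebra_left_comodule = bialgebra +
  fixes M and \<rho>
  assumes \<rho>_linear: "linear_map K M (H \<boxtimes> M) \<rho>"
    and \<rho>_coassoc: "m \<in> carrier M \<Longrightarrow>
      tensor_assoc K H H M (tensor_map K (H \<boxtimes> H) M \<Delta> (\<lambda>n. n) (\<rho> m))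
        = tensor_map K H (H \<boxtimes> M) (\<lambda>x. x) \<rho> (\<rho> m)"

locale yetter_drinfeld_module =
  bialgebra_left_module K H \<mu> \<Delta> M act + bialgebra_left_comodule K H \<mu> \<Delta> M \<rho>
  for K (structure) and H and \<mu> and \<Delta> and M and act and \<rho> +
  assumes yetter_drinfeld: "\<lbrakk>h \<in> carrier H; m \<in> carrier M\<rbrakk> \<Longrightarrow>
      tensor_lift K (H \<boxtimes> M) (\<lambda>h1 h2.
        tensor_lift K (H \<boxtimes> M) (\<lambda>x n. pure_tensor K H M (\<mu> x h2) n) (\<rho> (act h1 m))) (\<Delta> h)
      = tensor_lift K (H \<boxtimes> M) (\<lambda>h1 h2.
        tensor_lift K (H \<boxtimes> M) (\<lambda>x n. pure_tensor K H M (\<mu> h1 x) (act h2 n)) (\<rho> m)) (\<Delta> h)"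


section \<open>Hom-bialgebras and Yetter-Drinfeld modules over them\<close>

locale hom_bialgebra =
  fixes K (structure) and H and \<mu> and \<Delta> and \<alpha>
  assumes vectorspace: "vectorspace K H"
    and \<mu>_bilinear: "bilinear_map K H H H \<mu>"
    and \<Delta>_linear: "linear_map K H (H \<boxtimes> H) \<Delta>"
    and \<alpha>_linear: "linear_map K H H \<alpha>"
    and \<alpha>_mult: "\<lbrakk>x \<in> carrier H; y \<in> carrier H\<rbrakk> \<Longrightarrow> \<alpha> (\<mu> x y) = \<mu> (\<alpha> x) (\<alpha> y)"
    and hom_assoc: "\<lbrakk>x \<in> carrier H; y \<in> carrier H; z \<in> carrier H\<rbrakk> \<Longrightarrow>
      \<mu> (\<alpha> x) (\<mu> y z) = \<mu> (\<mu> x y) (\<alpha> z)"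
    and hom_coassoc: "x \<in> carrier H \<Longrightarrow>
      tensor_assoc K H H H (tensor_map K (H \<boxtimes> H) H \<Delta> \<alpha> (\<Delta> x))
        = tensor_map K H (H \<boxtimes> H) \<alpha> \<Delta> (\<Delta> x)"
    and \<Delta>_mult: "\<lbrakk>x \<in> carrier H; y \<in> carrier H\<rbrakk> \<Longrightarrow>
      \<Delta> (\<mu> x y)
        = tensor_lift K (H \<boxtimes> H) (\<lambda>x1 x2.
            tensor_lift K (H \<boxtimes> H) (\<lambda>y1 y2. pure_tensor K H H (\<mu> x1 y1) (\<mu> x2 y2)) (\<Delta> y)) (\<Delta> x)"
    and \<alpha>_comult: "x \<in> carrier H \<Longrightarrow> \<Delta> (\<alpha> x) = tensor_map K H H \<alpha> \<alpha> (\<Delta> x)"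

locale hom_left_module = hom_bialgebra K H \<mu> \<Delta> \<alpha>\<^sub>H
  for K (structure) and H and \<mu> and \<Delta> and \<alpha>\<^sub>H +
  fixes M and \<alpha>\<^sub>M and act
  assumes \<alpha>\<^sub>M_linear: "linear_map K M M \<alpha>\<^sub>M"
    and act_bilinear: "bilinear_map K H M M act"
    and \<alpha>\<^sub>M_act: "\<lbrakk>h \<in> carrier H; m \<in> carrier M\<rbrakk> \<Longrightarrow> \<alpha>\<^sub>M (act h m) = act (\<alpha>\<^sub>H h) (\<alpha>\<^sub>M m)"
    and act_hom_assoc: "\<lbrakk>x \<in> carrier H; y \<in> carrier H; m \<in> carrier M\<rbrakk> \<Longrightarrow>
      act (\<alpha>\<^sub>H x) (act y m) = act (\<mu> x y) (\<alpha>\<^sub>M m)"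

locale hom_left_comodule = hom_bialgebra K H \<mu> \<Delta> \<alpha>\<^sub>H
  for K (structure) and H and \<mu> and \<Delta> and \<alpha>\<^sub>H +
  fixes M and \<alpha>\<^sub>M and \<rho>
  assumes \<alpha>\<^sub>M_linear: "linear_map K M M \<alpha>\<^sub>M"
    and \<rho>_linear: "linear_map K M (H \<boxtimes> M) \<rho>"
    and \<alpha>\<^sub>M_\<rho>: "m \<in> carrier M \<Longrightarrow> tensor_map K H M \<alpha>\<^sub>H \<alpha>\<^sub>M (\<rho> m) = \<rho> (\<alpha>\<^sub>M m)"
    and \<rho>_hom_coassoc: "m \<in> carrier M \<Longrightarrow>
      tensor_assoc K H H M (tensor_map K (H \<boxtimes> H) M \<Delta> \<alpha>\<^sub>M (\<rho> m))
        = tensor_map K H (H \<boxtimes> M) \<alpha>\<^sub>H \<rho> (\<rho> m)"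

locale hom_yetter_drinfeld_module =
  hom_left_module K H \<mu> \<Delta> \<alpha>\<^sub>H M \<alpha>\<^sub>M act + hom_left_comodule K H \<mu> \<Delta> \<alpha>\<^sub>H M \<alpha>\<^sub>M \<rho>
  for K (structure) and H and \<mu> and \<Delta> and \<alpha>\<^sub>H and M and \<alpha>\<^sub>M and act and \<rho> +
  assumes hom_yetter_drinfeld: "\<lbrakk>h \<in> carrier H; m \<in> carrier M\<rbrakk> \<Longrightarrow>
      tensor_lift K (H \<boxtimes> M) (\<lambda>h1 h2.
        tensor_lift K (H \<boxtimes> M) (\<lambda>x n. pure_tensor K H M (\<mu> x (\<alpha>\<^sub>H (\<alpha>\<^sub>H h2))) n) (\<rho> (act h1 m))) (\<Delta> h)
      = tensor_lift K (H \<boxtimes> M) (\<lambda>h1 h2.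
        tensor_lift K (H \<boxtimes> M)
          (\<lambda>x n. pure_tensor K H M (\<mu> (\<alpha>\<^sub>H (\<alpha>\<^sub>H h1)) (\<alpha>\<^sub>H x)) (act (\<alpha>\<^sub>H h2) n)) (\<rho> m)) (\<Delta> h)"

end

theory Submission
  imports Defs
begin

text \<open>
  In both Yetter-Drinfeld expressions over the twisted Hom-bialgebra, multiplicativity of
  \<open>\<alpha>\<^sub>H\<close> and compatibility of \<open>\<alpha>\<^sub>M\<close> with action and coaction allow all twists to be moved outside:
  each side is the image under \<open>\<alpha>\<^sub>H\<^sup>3 \<otimes> \<alpha>\<^sub>M\<^sup>2\<close> of the corresponding side of the untwisted
  Yetter-Drinfeld condition at \<open>(\<alpha>\<^sub>H(h), m)\<close>. Likewise Hom-coassociativity of the twisted coaction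
  is the image of coassociativity under the tensor product of the squared twists.
\<close>

section \<open>Linear and bilinear maps\<close>

lemma linear_mapI:
  assumes "vectorspace K V" "vectorspace K W"
    and "\<And>v. v \<in> carrier V \<Longrightarrow> T v \<in> carrier W"
    and "\<And>v w. \<lbrakk>v \<in> carrier V; w \<in> carrier V\<rbrakk> \<Longrightarrow> T (v \<oplus>\<^bsub>V\<^esub> w) = T v \<oplus>\<^bsub>W\<^esub> T w"
    and "\<And>c v. \<lbrakk>c \<in> carrier K; v \<in> carrier V\<rbrakk> \<Longrightarrow> T (c \<odot>\<^bsub>V\<^esub> v) = c \<odot>\<^bsub>W\<^esub> T v"
  shows "linear_map K V W T"
  using assms
  by (auto intro!: linear_map.intro mod_hom.intro mod_hom_axioms.intro
      simp: module_hom_def vectorspace_def)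

lemma linear_map_vectorspace:
  assumes "linear_map K V W T"
  shows "vectorspace K V" "vectorspace K W"
  using assms by (auto simp: linear_map_def)

lemma vectorspace_closed:
  assumes "vectorspace K V"
  shows "\<lbrakk>v \<in> carrier V; w \<in> carrier V\<rbrakk> \<Longrightarrow> v \<oplus>\<^bsub>V\<^esub> w \<in> carrier V"
    and "\<lbrakk>c \<in> carrier K; v \<in> carrier V\<rbrakk> \<Longrightarrow> c \<odot>\<^bsub>V\<^esub> v \<in> carrier V"
proof -
  interpret vectorspace K V by fact
  show "\<lbrakk>v \<in> carrier V; w \<in> carrier V\<rbrakk> \<Longrightarrow> v \<oplus>\<^bsub>V\<^esub> w \<in> carrier V" by (rule M.a_closed)
  show "\<lbrakk>c \<in> carrier K; v \<in> carrier V\<rbrakk> \<Longrightarrow> c \<odot>\<^bsub>V\<^esub> v \<in> carrier V" by (rule smult_closed)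
qed

lemma linear_map_ident: "vectorspace K V \<Longrightarrow> linear_map K V V (\<lambda>v. v)"
  by (rule linear_mapI) auto

lemma linear_map_comp:
  assumes T: "linear_map K U V T" and S: "linear_map K V W S"
  shows "linear_map K U W (\<lambda>u. S (T u))"
  by (rule linear_mapI[OF linear_map_vectorspace(1)[OF T] linear_map_vectorspace(2)[OF S]])
    (simp_all add: linear_map.T_im[OF T] linear_map.T_im[OF S] linear_map.T_add[OF T]
      linear_map.T_add[OF S] linear_map.T_smult[OF T] linear_map.T_smult[OF S])

lemma linear_map_cong:
  assumes T: "linear_map K V W T" and eq: "\<And>v. v \<in> carrier V \<Longrightarrow> S v = T v"
  shows "linear_map K V W S"
  using linear_map_vectorspace[OF T]
  by (intro linear_mapI)
    (simp_all add: eq vectorspace_closed[OF linear_map_vectorspace(1)[OF T]]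
      linear_map.T_im[OF T] linear_map.T_add[OF T] linear_map.T_smult[OF T])

lemma bilinear_mapI:
  assumes "\<And>a. a \<in> carrier A \<Longrightarrow> linear_map K B C (f a)"
    and "\<And>b. b \<in> carrier B \<Longrightarrow> linear_map K A C (\<lambda>a. f a b)"
  shows "bilinear_map K A B C f"
  using assms by (simp add: bilinear_map_def)

lemma bilinear_mapD:
  assumes "bilinear_map K A B C f"
  shows "a \<in> carrier A \<Longrightarrow> linear_map K B C (f a)"
    and "b \<in> carrier B \<Longrightarrow> linear_map K A C (\<lambda>a. f a b)"
  using assms by (simp_all add: bilinear_map_def)

lemma bilinear_map_closed:
  assumes "bilinear_map K A B C f" "a \<in> carrier A" "b \<in> carrier B"
  shows "f a b \<in> carrier C"
  by (rule linear_map.T_im[OF bilinear_mapD(1)[OF assms(1,2)] assms(3)])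

lemma bilinear_map_vectorspace:
  assumes A: "vectorspace K A" and f: "bilinear_map K A B C f"
  shows "vectorspace K C"
proof -
  interpret A: vectorspace K A by fact
  show ?thesis by (rule linear_map_vectorspace(2)[OF bilinear_mapD(1)[OF f A.M.zero_closed]])
qed

lemma bilinear_map_comp:
  assumes g: "linear_map K A C g" and h: "linear_map K B D h" and f: "bilinear_map K C D E f"
  shows "bilinear_map K A B E (\<lambda>a b. f (g a) (h b))"
proof (rule bilinear_mapI)
  show "linear_map K B E (\<lambda>b. f (g a) (h b))" if "a \<in> carrier A" for a
    by (rule linear_map_comp[OF h bilinear_mapD(1)[OF f linear_map.T_im[OF g that]]])
  show "linear_map K A E (\<lambda>a. f (g a) (h b))" if "b \<in> carrier B" for b
    by (rule linear_map_comp[OF g bilinear_mapD(2)[OF f linear_map.T_im[OF h that]]])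
qed

lemma linear_comp_bilinear:
  assumes f: "bilinear_map K A B C f" and T: "linear_map K C D T"
  shows "bilinear_map K A B D (\<lambda>a b. T (f a b))"
  by (intro bilinear_mapI linear_map_comp[OF _ T] bilinear_mapD[OF f])

lemma bilinear_map_cong:
  assumes f: "bilinear_map K A B C f"
    and eq: "\<And>a b. \<lbrakk>a \<in> carrier A; b \<in> carrier B\<rbrakk> \<Longrightarrow> g a b = f a b"
  shows "bilinear_map K A B C g"
proof (rule bilinear_mapI)
  show "linear_map K B C (g a)" if "a \<in> carrier A" for a
    by (rule linear_map_cong[OF bilinear_mapD(1)[OF f that] eq[OF that]])
  show "linear_map K A C (\<lambda>a. g a b)" if "b \<in> carrier B" for b
    by (rule linear_map_cong[OF bilinear_mapD(2)[OF f that] eq[OF _ that]])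
qed


section \<open>Calculus of tensor products\<close>

lemma free_space_induct [consumes 2, case_names zero add]:
  assumes K: "field K" and u: "u \<in> carrier (free_space K S)"
    and zero: "P \<zero>\<^bsub>free_space K S\<^esub>"
    and add: "\<And>c x u. \<lbrakk>c \<in> carrier K; x \<in> S; u \<in> carrier (free_space K S); P u\<rbrakk> \<Longrightarrow>
      P (c \<odot>\<^bsub>free_space K S\<^esub> free_gen K x \<oplus>\<^bsub>free_space K S\<^esub> u)"
  shows "P u"
proof -
  interpret field K by fact
  have "finite {x. u x \<noteq> \<zero>\<^bsub>K\<^esub>}" using u by (simp add: free_space_def)
  thus ?thesis using u
  proof (induction "{x. u x \<noteq> \<zero>\<^bsub>K\<^esub>}" arbitrary: u rule: finite_psubset_induct)
    case (psubset u)
    show ?case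
    proof (cases "\<exists>x. u x \<noteq> \<zero>\<^bsub>K\<^esub>")
      case False
      hence "u = \<zero>\<^bsub>free_space K S\<^esub>" by (auto simp: free_space_def)
      thus ?thesis using zero by simp
    next
      case True
      then obtain x where x: "u x \<noteq> \<zero>\<^bsub>K\<^esub>" ..
      let ?v = "u(x := \<zero>\<^bsub>K\<^esub>)"
      have sub: "{y. ?v y \<noteq> \<zero>\<^bsub>K\<^esub>} \<subset> {y. u y \<noteq> \<zero>\<^bsub>K\<^esub>}" using x by auto
      have v: "?v \<in> carrier (free_space K S)"
        using psubset.prems finite_subset[OF psubset_imp_subset[OF sub]]
        by (auto simp: free_space_def)
      have uK: "u y \<in> carrier K" for y using psubset.prems by (simp add: free_space_def)
      have "x \<in> S" using x psubset.prems by (auto simp: free_space_def)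
      hence "P (u x \<odot>\<^bsub>free_space K S\<^esub> free_gen K x \<oplus>\<^bsub>free_space K S\<^esub> ?v)"
        by (intro add uK v psubset.hyps(2)[OF sub]) auto
      also have "u x \<odot>\<^bsub>free_space K S\<^esub> free_gen K x \<oplus>\<^bsub>free_space K S\<^esub> ?v = u"
        using uK by (auto simp: free_space_def free_gen_def)
      finally show ?thesis .
    qed
  qed
qed

lemma tensor_induct [consumes 3, case_names pure add smult]:
  assumes A: "vectorspace K A" and B: "vectorspace K B" and t: "t \<in> carrier (A \<boxtimes>\<^bsub>K\<^esub> B)"
    and pure: "\<And>a b. \<lbrakk>a \<in> carrier A; b \<in> carrier B\<rbrakk> \<Longrightarrow> P (pure_tensor K A B a b)"
    and add: "\<And>s t. \<lbrakk>s \<in> carrier (A \<boxtimes>\<^bsub>K\<^esub> B); t \<in> carrier (A \<boxtimes>\<^bsub>K\<^esub> B); P s; P t\<rbrakk> \<Longrightarrow>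
      P (s \<oplus>\<^bsub>A \<boxtimes>\<^bsub>K\<^esub> B\<^esub> t)"
    and smult: "\<And>c t. \<lbrakk>c \<in> carrier K; t \<in> carrier (A \<boxtimes>\<^bsub>K\<^esub> B); P t\<rbrakk> \<Longrightarrow> P (c \<odot>\<^bsub>A \<boxtimes>\<^bsub>K\<^esub> B\<^esub> t)"
  shows "P t"
proof -
  interpret A: vectorspace K A by fact
  interpret B: vectorspace K B by fact
  let ?F = "free_space K (carrier A \<times> carrier B)"
  let ?N = "tensor_null K A B"
  interpret F: vectorspace K ?F by (rule free_space_vectorspace) (fact A.field_axioms)
  interpret T: vectorspace K "A \<boxtimes>\<^bsub>K\<^esub> B" by (rule tensor_space_vectorspace[OF A B])
  interpret p: linear_map K ?F "A \<boxtimes>\<^bsub>K\<^esub> B" "\<lambda>u. ?N +>\<^bsub>?F\<^esub> u"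
    unfolding tensor_space_def
    by (rule quotient_space_proj[OF F.vectorspace_axioms tensor_null_submodule(1)[OF A B]])
  note pure_closed = bilinear_map_closed[OF pure_tensor_bilinear[OF A B]]
  obtain u where u: "u \<in> carrier ?F" "t = ?N +>\<^bsub>?F\<^esub> u"
    using t by (auto simp: tensor_space_def quotient_space_def A_RCOSETS_def')
  have "P (?N +>\<^bsub>?F\<^esub> u)"
    using A.field_axioms u(1)
  proof (induction rule: free_space_induct)
    case zero
    have z: "pure_tensor K A B \<zero>\<^bsub>A\<^esub> \<zero>\<^bsub>B\<^esub> \<in> carrier (A \<boxtimes>\<^bsub>K\<^esub> B)"
      by (intro pure_closed A.M.zero_closed B.M.zero_closed)
    have "P (\<zero>\<^bsub>K\<^esub> \<odot>\<^bsub>A \<boxtimes>\<^bsub>K\<^esub> B\<^esub> pure_tensor K A B \<zero>\<^bsub>A\<^esub> \<zero>\<^bsub>B\<^esub>)"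
      by (intro smult z pure A.M.zero_closed B.M.zero_closed A.R.zero_closed)
    also have "\<zero>\<^bsub>K\<^esub> \<odot>\<^bsub>A \<boxtimes>\<^bsub>K\<^esub> B\<^esub> pure_tensor K A B \<zero>\<^bsub>A\<^esub> \<zero>\<^bsub>B\<^esub> = \<zero>\<^bsub>A \<boxtimes>\<^bsub>K\<^esub> B\<^esub>"
      by (rule T.smult_l_null[OF z])
    also have "\<dots> = ?N +>\<^bsub>?F\<^esub> \<zero>\<^bsub>?F\<^esub>" by (rule p.f0_is_0[symmetric])
    finally show ?case .
  next
    case (add c x u)
    obtain a b where x: "x = (a, b)" and ab: "a \<in> carrier A" "b \<in> carrier B"
      using add.hyps(2) by auto
    have gen: "free_gen K (a, b) \<in> carrier ?F"
      using free_gen_closed[OF A.field_axioms add.hyps(2)] by (simp only: x)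
    have eq: "?N +>\<^bsub>?F\<^esub> (c \<odot>\<^bsub>?F\<^esub> free_gen K x \<oplus>\<^bsub>?F\<^esub> u)
        = c \<odot>\<^bsub>A \<boxtimes>\<^bsub>K\<^esub> B\<^esub> pure_tensor K A B a b \<oplus>\<^bsub>A \<boxtimes>\<^bsub>K\<^esub> B\<^esub> (?N +>\<^bsub>?F\<^esub> u)"
      by (simp only: x pure_tensor_def p.T_add[OF F.smult_closed[OF add.hyps(1) gen] add.hyps(3)]
          p.T_smult[OF add.hyps(1) gen])
    show ?case unfolding eq
      by (intro assms(5) assms(6) assms(4) T.smult_closed pure_closed ab add p.T_im)
  qed
  thus ?thesis by (simp only: u(2))
qed

lemma tensor_ext:
  assumes A: "vectorspace K A" and B: "vectorspace K B"
    and T: "linear_map K (A \<boxtimes>\<^bsub>K\<^esub> B) C T" and S: "linear_map K (A \<boxtimes>\<^bsub>K\<^esub> B) C S"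
    and eq: "\<And>a b. \<lbrakk>a \<in> carrier A; b \<in> carrier B\<rbrakk> \<Longrightarrow>
      T (pure_tensor K A B a b) = S (pure_tensor K A B a b)"
    and t: "t \<in> carrier (A \<boxtimes>\<^bsub>K\<^esub> B)"
  shows "T t = S t"
  using A B t
  by (induction rule: tensor_induct)
    (simp_all add: eq linear_map.T_add[OF T] linear_map.T_add[OF S]
      linear_map.T_smult[OF T] linear_map.T_smult[OF S])

lemma tensor_lift_cong:
  assumes A: "vectorspace K A" and B: "vectorspace K B" and f: "bilinear_map K A B C f"
    and eq: "\<And>a b. \<lbrakk>a \<in> carrier A; b \<in> carrier B\<rbrakk> \<Longrightarrow> g a b = f a b"
    and t: "t \<in> carrier (A \<boxtimes>\<^bsub>K\<^esub> B)"
  shows "tensor_lift K C g t = tensor_lift K C f t"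
proof -
  have g: "bilinear_map K A B C g" by (rule bilinear_map_cong[OF f eq])
  note C = bilinear_map_vectorspace[OF A f]
  show ?thesis
    by (rule tensor_ext[OF A B tensor_lift_linear[OF A B C g] tensor_lift_linear[OF A B C f] _ t])
      (simp add: tensor_lift_pure[OF A B C f] tensor_lift_pure[OF A B C g] eq)
qed

lemma linear_map_tensor_lift:
  assumes A: "vectorspace K A" and B: "vectorspace K B" and f: "bilinear_map K A B C f"
    and T: "linear_map K C D T" and t: "t \<in> carrier (A \<boxtimes>\<^bsub>K\<^esub> B)"
  shows "T (tensor_lift K C f t) = tensor_lift K D (\<lambda>a b. T (f a b)) t"
proof -
  note C = linear_map_vectorspace(1)[OF T] and D = linear_map_vectorspace(2)[OF T]
  note Tf = linear_comp_bilinear[OF f T]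
  show ?thesis
    by (rule tensor_ext[OF A B linear_map_comp[OF tensor_lift_linear[OF A B C f] T]
          tensor_lift_linear[OF A B D Tf] _ t])
      (simp add: tensor_lift_pure[OF A B C f] tensor_lift_pure[OF A B D Tf])
qed

lemma tensor_lift_param_linear:
  assumes A: "vectorspace K A" and B: "vectorspace K B" and X: "vectorspace K X"
    and F: "\<And>x. x \<in> carrier X \<Longrightarrow> bilinear_map K A B C (F x)"
    and lin: "\<And>a b. \<lbrakk>a \<in> carrier A; b \<in> carrier B\<rbrakk> \<Longrightarrow> linear_map K X C (\<lambda>x. F x a b)"
    and t: "t \<in> carrier (A \<boxtimes>\<^bsub>K\<^esub> B)"
  shows "linear_map K X C (\<lambda>x. tensor_lift K C (F x) t)"
proof -
  interpret A: vectorspace K A by fact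
  interpret B: vectorspace K B by fact
  have C: "vectorspace K C"
    by (rule linear_map_vectorspace(2)[OF lin[OF A.M.zero_closed B.M.zero_closed]])
  interpret C: vectorspace K C by (rule C)
  note L = tensor_lift_linear[OF A B C F]
  note sum_closed = vectorspace_closed(1)[OF X] and smult_closed = vectorspace_closed(2)[OF X]
  note L_simps = linear_map.T_add[OF L] linear_map.T_smult[OF L] linear_map.T_im[OF L]
  show ?thesis
    using A B t
  proof (induction rule: tensor_induct)
    case (pure a b)
    show ?case
      by (rule linear_map_cong[OF lin[OF pure]]) (rule tensor_lift_pure[OF A B C F pure])
  next
    case (add s t)
    show ?case
    proof (rule linear_mapI[OF X C])
      fix x y assume xy: "x \<in> carrier X" "y \<in> carrier X"
      show "tensor_lift K C (F (x \<oplus>\<^bsub>X\<^esub> y)) (s \<oplus>\<^bsub>A \<boxtimes>\<^bsub>K\<^esub> B\<^esub> t)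
          = tensor_lift K C (F x) (s \<oplus>\<^bsub>A \<boxtimes>\<^bsub>K\<^esub> B\<^esub> t) \<oplus>\<^bsub>C\<^esub> tensor_lift K C (F y) (s \<oplus>\<^bsub>A \<boxtimes>\<^bsub>K\<^esub> B\<^esub> t)"
        using xy add by (simp add: L_simps sum_closed linear_map.T_add[OF add.IH(1)]
            linear_map.T_add[OF add.IH(2)] C.M.a_ac)
    next
      fix c x assume cx: "c \<in> carrier K" "x \<in> carrier X"
      show "tensor_lift K C (F (c \<odot>\<^bsub>X\<^esub> x)) (s \<oplus>\<^bsub>A \<boxtimes>\<^bsub>K\<^esub> B\<^esub> t)
          = c \<odot>\<^bsub>C\<^esub> tensor_lift K C (F x) (s \<oplus>\<^bsub>A \<boxtimes>\<^bsub>K\<^esub> B\<^esub> t)"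
        using cx add by (simp add: L_simps smult_closed linear_map.T_smult[OF add.IH(1)]
            linear_map.T_smult[OF add.IH(2)] C.smult_r_distr)
    qed (use add in \<open>simp add: L_simps\<close>)
  next
    case (smult d t)
    show ?case
    proof (rule linear_mapI[OF X C])
      fix x y assume xy: "x \<in> carrier X" "y \<in> carrier X"
      show "tensor_lift K C (F (x \<oplus>\<^bsub>X\<^esub> y)) (d \<odot>\<^bsub>A \<boxtimes>\<^bsub>K\<^esub> B\<^esub> t)
          = tensor_lift K C (F x) (d \<odot>\<^bsub>A \<boxtimes>\<^bsub>K\<^esub> B\<^esub> t) \<oplus>\<^bsub>C\<^esub> tensor_lift K C (F y) (d \<odot>\<^bsub>A \<boxtimes>\<^bsub>K\<^esub> B\<^esub> t)"
        using xy smult by (simp add: L_simps sum_closed linear_map.T_add[OF smult.IH]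
            C.smult_r_distr)
    next
      fix c x assume cx: "c \<in> carrier K" "x \<in> carrier X"
      show "tensor_lift K C (F (c \<odot>\<^bsub>X\<^esub> x)) (d \<odot>\<^bsub>A \<boxtimes>\<^bsub>K\<^esub> B\<^esub> t)
          = c \<odot>\<^bsub>C\<^esub> tensor_lift K C (F x) (d \<odot>\<^bsub>A \<boxtimes>\<^bsub>K\<^esub> B\<^esub> t)"
        using cx smult by (simp add: L_simps smult_closed linear_map.T_smult[OF smult.IH]
            C.smult_assoc1[symmetric] A.R.m_comm)
    qed (use smult in \<open>simp add: L_simps\<close>)
  qed
qed

lemma tensor_map:
  assumes f: "linear_map K A C f" and g: "linear_map K B D g"
  shows tensor_map_linear: "linear_map K (A \<boxtimes>\<^bsub>K\<^esub> B) (C \<boxtimes>\<^bsub>K\<^esub> D) (tensor_map K C D f g)"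
    and tensor_map_pure: "\<lbrakk>a \<in> carrier A; b \<in> carrier B\<rbrakk> \<Longrightarrow>
      tensor_map K C D f g (pure_tensor K A B a b) = pure_tensor K C D (f a) (g b)"
proof -
  note vs = linear_map_vectorspace[OF f] linear_map_vectorspace[OF g]
  note bil = bilinear_map_comp[OF f g pure_tensor_bilinear[OF vs(2,4)]]
  show "linear_map K (A \<boxtimes>\<^bsub>K\<^esub> B) (C \<boxtimes>\<^bsub>K\<^esub> D) (tensor_map K C D f g)"
    unfolding tensor_map_def
    by (rule tensor_lift_linear[OF vs(1,3) tensor_space_vectorspace[OF vs(2,4)] bil])
  show "\<lbrakk>a \<in> carrier A; b \<in> carrier B\<rbrakk> \<Longrightarrow>
      tensor_map K C D f g (pure_tensor K A B a b) = pure_tensor K C D (f a) (g b)"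
    unfolding tensor_map_def
    by (rule tensor_lift_pure[OF vs(1,3) tensor_space_vectorspace[OF vs(2,4)] bil])
qed

lemma tensor_lift_tensor_map:
  assumes f: "linear_map K A C f" and g: "linear_map K B D g" and F: "bilinear_map K C D E F"
    and t: "t \<in> carrier (A \<boxtimes>\<^bsub>K\<^esub> B)"
  shows "tensor_lift K E F (tensor_map K C D f g t) = tensor_lift K E (\<lambda>a b. F (f a) (g b)) t"
proof -
  note vs = linear_map_vectorspace[OF f] linear_map_vectorspace[OF g]
  note E = bilinear_map_vectorspace[OF vs(2) F]
  note bil = bilinear_map_comp[OF f g F]
  show ?thesis
    by (rule tensor_ext[OF vs(1,3) linear_map_comp[OF tensor_map_linear[OF f g]
          tensor_lift_linear[OF vs(2,4) E F]] tensor_lift_linear[OF vs(1,3) E bil] _ t])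
      (simp add: tensor_map_pure[OF f g] tensor_lift_pure[OF vs(2,4) E F]
        tensor_lift_pure[OF vs(1,3) E bil] linear_map.T_im[OF f] linear_map.T_im[OF g])
qed

lemma tensor_map_comp:
  assumes f: "linear_map K A C f" and g: "linear_map K B D g"
    and f': "linear_map K C C' f'" and g': "linear_map K D D' g'"
    and t: "t \<in> carrier (A \<boxtimes>\<^bsub>K\<^esub> B)"
  shows "tensor_map K C' D' f' g' (tensor_map K C D f g t)
    = tensor_map K C' D' (\<lambda>a. f' (f a)) (\<lambda>b. g' (g b)) t"
  unfolding tensor_map_def[of K C' D']
  by (rule tensor_lift_tensor_map[OF f g bilinear_map_comp[OF f' g' pure_tensor_bilinear] t])
    (rule linear_map_vectorspace(2)[OF f'] linear_map_vectorspace(2)[OF g'])+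

lemma tensor_map_cong:
  assumes f: "linear_map K A C f" and g: "linear_map K B D g"
    and "\<And>a. a \<in> carrier A \<Longrightarrow> f' a = f a" and "\<And>b. b \<in> carrier B \<Longrightarrow> g' b = g b"
    and t: "t \<in> carrier (A \<boxtimes>\<^bsub>K\<^esub> B)"
  shows "tensor_map K C D f' g' t = tensor_map K C D f g t"
proof -
  note vs = linear_map_vectorspace[OF f] linear_map_vectorspace[OF g]
  show ?thesis
    unfolding tensor_map_def
    by (rule tensor_lift_cong[OF vs(1,3) bilinear_map_comp[OF f g pure_tensor_bilinear[OF vs(2,4)]]
          _ t]) (simp add: assms(3,4))
qed

lemma tensor_assoc:
  assumes A: "vectorspace K A" and B: "vectorspace K B" and C: "vectorspace K C"
  shows tensor_assoc_linear:
      "linear_map K ((A \<boxtimes>\<^bsub>K\<^esub> B) \<boxtimes>\<^bsub>K\<^esub> C) (A \<boxtimes>\<^bsub>K\<^esub> (B \<boxtimes>\<^bsub>K\<^esub> C)) (tensor_assoc K A B C)"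
    and tensor_assoc_pure: "\<lbrakk>a \<in> carrier A; b \<in> carrier B; c \<in> carrier C\<rbrakk> \<Longrightarrow>
      tensor_assoc K A B C (pure_tensor K (A \<boxtimes>\<^bsub>K\<^esub> B) C (pure_tensor K A B a b) c)
        = pure_tensor K A (B \<boxtimes>\<^bsub>K\<^esub> C) a (pure_tensor K B C b c)"
proof -
  note AB = tensor_space_vectorspace[OF A B] and BC = tensor_space_vectorspace[OF B C]
  note ABC = tensor_space_vectorspace[OF A BC]
  note p = pure_tensor_bilinear[OF A BC] and q = pure_tensor_bilinear[OF B C]
  have inner: "bilinear_map K A B (A \<boxtimes>\<^bsub>K\<^esub> (B \<boxtimes>\<^bsub>K\<^esub> C))
      (\<lambda>a b. pure_tensor K A (B \<boxtimes>\<^bsub>K\<^esub> C) a (pure_tensor K B C b c))" if "c \<in> carrier C" for c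
    by (rule bilinear_map_comp[OF linear_map_ident[OF A] bilinear_mapD(2)[OF q that] p])
  have lin: "linear_map K C (A \<boxtimes>\<^bsub>K\<^esub> (B \<boxtimes>\<^bsub>K\<^esub> C))
      (\<lambda>c. pure_tensor K A (B \<boxtimes>\<^bsub>K\<^esub> C) a (pure_tensor K B C b c))"
    if "a \<in> carrier A" "b \<in> carrier B" for a b
    by (rule linear_map_comp[OF bilinear_mapD(1)[OF q that(2)] bilinear_mapD(1)[OF p that(1)]])
  have outer: "bilinear_map K (A \<boxtimes>\<^bsub>K\<^esub> B) C (A \<boxtimes>\<^bsub>K\<^esub> (B \<boxtimes>\<^bsub>K\<^esub> C))
      (\<lambda>t c. tensor_lift K (A \<boxtimes>\<^bsub>K\<^esub> (B \<boxtimes>\<^bsub>K\<^esub> C))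
        (\<lambda>a b. pure_tensor K A (B \<boxtimes>\<^bsub>K\<^esub> C) a (pure_tensor K B C b c)) t)"
    by (intro bilinear_mapI tensor_lift_param_linear[OF A B C] tensor_lift_linear[OF A B ABC]
        inner lin)
  show "linear_map K ((A \<boxtimes>\<^bsub>K\<^esub> B) \<boxtimes>\<^bsub>K\<^esub> C) (A \<boxtimes>\<^bsub>K\<^esub> (B \<boxtimes>\<^bsub>K\<^esub> C)) (tensor_assoc K A B C)"
    unfolding tensor_assoc_def by (rule tensor_lift_linear[OF AB C ABC outer])
  show "tensor_assoc K A B C (pure_tensor K (A \<boxtimes>\<^bsub>K\<^esub> B) C (pure_tensor K A B a b) c)
      = pure_tensor K A (B \<boxtimes>\<^bsub>K\<^esub> C) a (pure_tensor K B C b c)"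
    if "a \<in> carrier A" "b \<in> carrier B" "c \<in> carrier C"
    using that
    by (simp add: tensor_assoc_def tensor_lift_pure[OF AB C ABC outer]
        tensor_lift_pure[OF A B ABC inner] bilinear_map_closed[OF pure_tensor_bilinear[OF A B]])
qed

lemma tensor_ext_left_nested:
  assumes A: "vectorspace K A" and B: "vectorspace K B" and C: "vectorspace K C"
    and T: "linear_map K ((A \<boxtimes>\<^bsub>K\<^esub> B) \<boxtimes>\<^bsub>K\<^esub> C) D T" and S: "linear_map K ((A \<boxtimes>\<^bsub>K\<^esub> B) \<boxtimes>\<^bsub>K\<^esub> C) D S"
    and eq: "\<And>a b c. \<lbrakk>a \<in> carrier A; b \<in> carrier B; c \<in> carrier C\<rbrakk> \<Longrightarrow>
      T (pure_tensor K (A \<boxtimes>\<^bsub>K\<^esub> B) C (pure_tensor K A B a b) c)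
        = S (pure_tensor K (A \<boxtimes>\<^bsub>K\<^esub> B) C (pure_tensor K A B a b) c)"
    and t: "t \<in> carrier ((A \<boxtimes>\<^bsub>K\<^esub> B) \<boxtimes>\<^bsub>K\<^esub> C)"
  shows "T t = S t"
proof (rule tensor_ext[OF tensor_space_vectorspace[OF A B] C T S _ t])
  fix s c assume s: "s \<in> carrier (A \<boxtimes>\<^bsub>K\<^esub> B)" and c: "c \<in> carrier C"
  note lin = bilinear_mapD(2)[OF pure_tensor_bilinear[OF tensor_space_vectorspace[OF A B] C] c]
  show "T (pure_tensor K (A \<boxtimes>\<^bsub>K\<^esub> B) C s c) = S (pure_tensor K (A \<boxtimes>\<^bsub>K\<^esub> B) C s c)"
    by (rule tensor_ext[OF A B linear_map_comp[OF lin T] linear_map_comp[OF lin S] eq[OF _ _ c] s])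
qed

lemma tensor_assoc_natural:
  assumes f: "linear_map K A A' f" and g: "linear_map K B B' g" and h: "linear_map K C C' h"
    and t: "t \<in> carrier ((A \<boxtimes>\<^bsub>K\<^esub> B) \<boxtimes>\<^bsub>K\<^esub> C)"
  shows "tensor_assoc K A' B' C' (tensor_map K (A' \<boxtimes>\<^bsub>K\<^esub> B') C' (tensor_map K A' B' f g) h t)
    = tensor_map K A' (B' \<boxtimes>\<^bsub>K\<^esub> C') f (tensor_map K B' C' g h) (tensor_assoc K A B C t)"
proof -
  note A = linear_map_vectorspace[OF f] and B = linear_map_vectorspace[OF g]
    and C = linear_map_vectorspace[OF h]
  note fg = tensor_map_linear[OF f g] and gh = tensor_map_linear[OF g h]
  note ass = tensor_assoc_linear[OF A(1) B(1) C(1)] and ass' = tensor_assoc_linear[OF A(2) B(2) C(2)]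
  show ?thesis
    by (rule tensor_ext_left_nested[OF A(1) B(1) C(1)
          linear_map_comp[OF tensor_map_linear[OF fg h] ass']
          linear_map_comp[OF ass tensor_map_linear[OF f gh]] _ t])
      (simp add: tensor_map_pure[OF fg h] tensor_map_pure[OF f gh] tensor_map_pure[OF f g]
        tensor_map_pure[OF g h] tensor_assoc_pure[OF A(1) B(1) C(1)]
        tensor_assoc_pure[OF A(2) B(2) C(2)] linear_map.T_im[OF f] linear_map.T_im[OF g]
        linear_map.T_im[OF h] bilinear_map_closed[OF pure_tensor_bilinear[OF A(1) B(1)]]
        bilinear_map_closed[OF pure_tensor_bilinear[OF B(1) C(1)]])
qed

lemma bilinear_tensor_lift_pure:
  assumes A: "vectorspace K A" and B: "vectorspace K B" and X: "vectorspace K X" and Y: "vectorspace K Y"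
    and f: "bilinear_map K A X C f" and g: "bilinear_map K B Y D g"
    and t: "t \<in> carrier (X \<boxtimes>\<^bsub>K\<^esub> Y)"
  shows "bilinear_map K A B (C \<boxtimes>\<^bsub>K\<^esub> D)
    (\<lambda>a b. tensor_lift K (C \<boxtimes>\<^bsub>K\<^esub> D) (\<lambda>x y. pure_tensor K C D (f a x) (g b y)) t)"
proof -
  note C = bilinear_map_vectorspace[OF A f] and D = bilinear_map_vectorspace[OF B g]
  note p = pure_tensor_bilinear[OF C D]
  have bil: "bilinear_map K X Y (C \<boxtimes>\<^bsub>K\<^esub> D) (\<lambda>x y. pure_tensor K C D (f a x) (g b y))"
    if "a \<in> carrier A" "b \<in> carrier B" for a b
    by (rule bilinear_map_comp[OF bilinear_mapD(1)[OF f that(1)] bilinear_mapD(1)[OF g that(2)] p])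
  show ?thesis
  proof (rule bilinear_mapI)
    fix a assume a: "a \<in> carrier A"
    show "linear_map K B (C \<boxtimes>\<^bsub>K\<^esub> D)
        (\<lambda>b. tensor_lift K (C \<boxtimes>\<^bsub>K\<^esub> D) (\<lambda>x y. pure_tensor K C D (f a x) (g b y)) t)"
      by (rule tensor_lift_param_linear[OF X Y B bil[OF a] _ t])
        (assumption, rule linear_map_comp[OF bilinear_mapD(2)[OF g] bilinear_mapD(1)[OF p
            bilinear_map_closed[OF f a]]])
  next
    fix b assume b: "b \<in> carrier B"
    show "linear_map K A (C \<boxtimes>\<^bsub>K\<^esub> D)
        (\<lambda>a. tensor_lift K (C \<boxtimes>\<^bsub>K\<^esub> D) (\<lambda>x y. pure_tensor K C D (f a x) (g b y)) t)"
      by (rule tensor_lift_param_linear[OF X Y A bil[OF _ b] _ t])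
        (assumption, rule linear_map_comp[OF bilinear_mapD(2)[OF f] bilinear_mapD(2)[OF p
            bilinear_map_closed[OF g b]]])
  qed
qed


section \<open>Twisting\<close>

lemma twisted_coaction_hom_coassoc:
  assumes endo: "bialgebra_endomorphism K H \<mu> \<Delta> \<alpha>\<^sub>H"
    and com: "bialgebra_left_comodule K H \<mu> \<Delta> M \<rho>"
    and \<alpha>\<^sub>M: "linear_map K M M \<alpha>\<^sub>M"
    and \<alpha>\<^sub>M_\<rho>: "\<And>m. m \<in> carrier M \<Longrightarrow> \<rho> (\<alpha>\<^sub>M m) = tensor_map K H M \<alpha>\<^sub>H \<alpha>\<^sub>M (\<rho> m)"
    and m: "m \<in> carrier M"
  shows "tensor_assoc K H H M
      (tensor_map K (H \<boxtimes>\<^bsub>K\<^esub> H) M (\<lambda>x. \<Delta> (\<alpha>\<^sub>H x)) \<alpha>\<^sub>M (\<rho> (\<alpha>\<^sub>M m)))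
    = tensor_map K H (H \<boxtimes>\<^bsub>K\<^esub> M) \<alpha>\<^sub>H (\<lambda>n. \<rho> (\<alpha>\<^sub>M n)) (\<rho> (\<alpha>\<^sub>M m))"
proof -
  interpret bialgebra_endomorphism K H \<mu> \<Delta> \<alpha>\<^sub>H by fact
  interpret bialgebra_left_comodule K H \<mu> \<Delta> M \<rho> by fact
  note H = vectorspace and M = linear_map_vectorspace(1)[OF \<alpha>\<^sub>M]
  let ?\<beta> = "\<lambda>x. \<alpha>\<^sub>H (\<alpha>\<^sub>H x)" and ?\<gamma> = "\<lambda>n. \<alpha>\<^sub>M (\<alpha>\<^sub>M n)"
  have \<beta>: "linear_map K H H ?\<beta>" by (rule linear_map_comp[OF \<alpha>_linear \<alpha>_linear])
  have \<gamma>: "linear_map K M M ?\<gamma>" by (rule linear_map_comp[OF \<alpha>\<^sub>M \<alpha>\<^sub>M])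
  note idH = linear_map_ident[OF H] and idM = linear_map_ident[OF M]
  note \<alpha>_closed = linear_map.T_im[OF \<alpha>_linear] and \<alpha>\<^sub>M_closed = linear_map.T_im[OF \<alpha>\<^sub>M]
  note \<Delta>_closed = linear_map.T_im[OF \<Delta>_linear] and \<rho>_closed = linear_map.T_im[OF \<rho>_linear]
  note \<beta>\<beta> = tensor_map_linear[OF \<beta> \<beta>] and \<beta>\<gamma> = tensor_map_linear[OF \<beta> \<gamma>]
  have \<Delta>_\<beta>: "\<Delta> (?\<beta> x) = tensor_map K H H ?\<beta> ?\<beta> (\<Delta> x)" if "x \<in> carrier H" for x
    using that by (simp add: \<alpha>_comult \<alpha>_closed \<Delta>_closed
        tensor_map_comp[OF \<alpha>_linear \<alpha>_linear \<alpha>_linear \<alpha>_linear])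
  have \<rho>_\<gamma>: "\<rho> (?\<gamma> n) = tensor_map K H M ?\<beta> ?\<gamma> (\<rho> n)" if "n \<in> carrier M" for n
    using that by (simp add: \<alpha>\<^sub>M_\<rho> \<alpha>\<^sub>M_closed \<rho>_closed
        tensor_map_comp[OF \<alpha>_linear \<alpha>\<^sub>M \<alpha>_linear \<alpha>\<^sub>M])
  note t = \<rho>_closed[OF m]
  have "tensor_map K (H \<boxtimes>\<^bsub>K\<^esub> H) M (\<lambda>x. \<Delta> (\<alpha>\<^sub>H x)) \<alpha>\<^sub>M (\<rho> (\<alpha>\<^sub>M m))
      = tensor_map K (H \<boxtimes>\<^bsub>K\<^esub> H) M (\<lambda>x. \<Delta> (?\<beta> x)) ?\<gamma> (\<rho> m)"
    unfolding \<alpha>\<^sub>M_\<rho>[OF m]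
    by (rule tensor_map_comp[OF \<alpha>_linear \<alpha>\<^sub>M linear_map_comp[OF \<alpha>_linear \<Delta>_linear] \<alpha>\<^sub>M t])
  also have "\<dots> = tensor_map K (H \<boxtimes>\<^bsub>K\<^esub> H) M (\<lambda>x. tensor_map K H H ?\<beta> ?\<beta> (\<Delta> x)) ?\<gamma> (\<rho> m)"
    by (rule tensor_map_cong[OF linear_map_comp[OF \<Delta>_linear \<beta>\<beta>] \<gamma> \<Delta>_\<beta> refl t])
  also have "\<dots> = tensor_map K (H \<boxtimes>\<^bsub>K\<^esub> H) M (tensor_map K H H ?\<beta> ?\<beta>) ?\<gamma>
      (tensor_map K (H \<boxtimes>\<^bsub>K\<^esub> H) M \<Delta> (\<lambda>n. n) (\<rho> m))"
    by (rule tensor_map_comp[OF \<Delta>_linear idM \<beta>\<beta> \<gamma> t, symmetric])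
  finally have "tensor_assoc K H H M
      (tensor_map K (H \<boxtimes>\<^bsub>K\<^esub> H) M (\<lambda>x. \<Delta> (\<alpha>\<^sub>H x)) \<alpha>\<^sub>M (\<rho> (\<alpha>\<^sub>M m)))
    = tensor_map K H (H \<boxtimes>\<^bsub>K\<^esub> M) ?\<beta> (tensor_map K H M ?\<beta> ?\<gamma>)
        (tensor_map K H (H \<boxtimes>\<^bsub>K\<^esub> M) (\<lambda>x. x) \<rho> (\<rho> m))"
    by (simp only: \<rho>_coassoc[OF m, symmetric]
        tensor_assoc_natural[OF \<beta> \<beta> \<gamma> linear_map.T_im[OF tensor_map_linear[OF \<Delta>_linear idM] t]])
  also have "\<dots> = tensor_map K H (H \<boxtimes>\<^bsub>K\<^esub> M) ?\<beta> (\<lambda>n. tensor_map K H M ?\<beta> ?\<gamma> (\<rho> n)) (\<rho> m)"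
    by (rule tensor_map_comp[OF idH \<rho>_linear \<beta> \<beta>\<gamma> t])
  also have "\<dots> = tensor_map K H (H \<boxtimes>\<^bsub>K\<^esub> M) ?\<beta> (\<lambda>n. \<rho> (?\<gamma> n)) (\<rho> m)"
    by (rule tensor_map_cong[OF \<beta> linear_map_comp[OF \<gamma> \<rho>_linear] refl \<rho>_\<gamma>[symmetric] t])
  also have "\<dots> = tensor_map K H (H \<boxtimes>\<^bsub>K\<^esub> M) \<alpha>\<^sub>H (\<lambda>n. \<rho> (\<alpha>\<^sub>M n)) (\<rho> (\<alpha>\<^sub>M m))"
    unfolding \<alpha>\<^sub>M_\<rho>[OF m]
    by (rule tensor_map_comp[OF \<alpha>_linear \<alpha>\<^sub>M \<alpha>_linear linear_map_comp[OF \<alpha>\<^sub>M \<rho>_linear] t, symmetric])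
  finally show ?thesis .
qed

lemma twisted_bialgebra:
  assumes "bialgebra_endomorphism K H \<mu> \<Delta> \<alpha>"
  shows "hom_bialgebra K H (\<lambda>x y. \<alpha> (\<mu> x y)) (\<lambda>x. \<Delta> (\<alpha> x)) \<alpha>"
proof -
  interpret bialgebra_endomorphism K H \<mu> \<Delta> \<alpha> by fact
  note H = vectorspace
  note \<alpha>_closed = linear_map.T_im[OF \<alpha>_linear] and \<mu>_closed = bilinear_map_closed[OF \<mu>_bilinear]
    and \<Delta>_closed = linear_map.T_im[OF \<Delta>_linear]
  have com: "bialgebra_left_comodule K H \<mu> \<Delta> H \<Delta>"
    by (intro bialgebra_left_comodule.intro bialgebra_left_comodule_axioms.intro
        bialgebra_axioms \<Delta>_linear coassoc)
  show ?thesis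
  proof (rule hom_bialgebra.intro)
    show "bilinear_map K H H H (\<lambda>x y. \<alpha> (\<mu> x y))"
      by (rule linear_comp_bilinear[OF \<mu>_bilinear \<alpha>_linear])
    show "linear_map K H (H \<boxtimes>\<^bsub>K\<^esub> H) (\<lambda>x. \<Delta> (\<alpha> x))"
      by (rule linear_map_comp[OF \<alpha>_linear \<Delta>_linear])
    show "tensor_assoc K H H H (tensor_map K (H \<boxtimes>\<^bsub>K\<^esub> H) H (\<lambda>x. \<Delta> (\<alpha> x)) \<alpha> (\<Delta> (\<alpha> x)))
        = tensor_map K H (H \<boxtimes>\<^bsub>K\<^esub> H) \<alpha> (\<lambda>x. \<Delta> (\<alpha> x)) (\<Delta> (\<alpha> x))" if "x \<in> carrier H" for x
      by (rule twisted_coaction_hom_coassoc[OF assms com \<alpha>_linear \<alpha>_comult that])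
    fix x y assume x: "x \<in> carrier H" and y: "y \<in> carrier H"
    let ?x = "\<Delta> (\<alpha> x)" and ?y = "\<Delta> (\<alpha> y)"
    have xt: "?x \<in> carrier (H \<boxtimes>\<^bsub>K\<^esub> H)" and yt: "?y \<in> carrier (H \<boxtimes>\<^bsub>K\<^esub> H)"
      using x y by (auto intro: \<alpha>_closed \<Delta>_closed)
    let ?f = "\<lambda>x1 x2 y1 y2. pure_tensor K H H (\<mu> x1 y1) (\<mu> x2 y2)"
    let ?T = "tensor_map K H H \<alpha> \<alpha>"
    note T = tensor_map_linear[OF \<alpha>_linear \<alpha>_linear]
    have inner: "bilinear_map K H H (H \<boxtimes>\<^bsub>K\<^esub> H) (?f x1 x2)"
      if "x1 \<in> carrier H" "x2 \<in> carrier H" for x1 x2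
      by (rule bilinear_map_comp[OF bilinear_mapD(1)[OF \<mu>_bilinear that(1)]
            bilinear_mapD(1)[OF \<mu>_bilinear that(2)] pure_tensor_bilinear[OF H H]])
    note outer = bilinear_tensor_lift_pure[OF H H H H \<mu>_bilinear \<mu>_bilinear yt]
    have "\<Delta> (\<alpha> (\<alpha> (\<mu> x y))) = ?T (\<Delta> (\<mu> (\<alpha> x) (\<alpha> y)))"
      using x y by (simp add: \<alpha>_mult[symmetric] \<alpha>_comult \<alpha>_closed \<mu>_closed)
    also have "\<dots> = ?T (tensor_lift K (H \<boxtimes>\<^bsub>K\<^esub> H)
        (\<lambda>x1 x2. tensor_lift K (H \<boxtimes>\<^bsub>K\<^esub> H) (?f x1 x2) ?y) ?x)"
      by (simp only: \<Delta>_mult[OF \<alpha>_closed[OF x] \<alpha>_closed[OF y]])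
    also have "\<dots> = tensor_lift K (H \<boxtimes>\<^bsub>K\<^esub> H)
        (\<lambda>x1 x2. ?T (tensor_lift K (H \<boxtimes>\<^bsub>K\<^esub> H) (?f x1 x2) ?y)) ?x"
      by (rule linear_map_tensor_lift[OF H H outer T xt])
    also have "\<dots> = tensor_lift K (H \<boxtimes>\<^bsub>K\<^esub> H) (\<lambda>x1 x2. tensor_lift K (H \<boxtimes>\<^bsub>K\<^esub> H)
        (\<lambda>y1 y2. pure_tensor K H H (\<alpha> (\<mu> x1 y1)) (\<alpha> (\<mu> x2 y2))) ?y) ?x"
    proof (rule tensor_lift_cong[OF H H linear_comp_bilinear[OF outer T] _ xt, symmetric])
      fix x1 x2 assume x12: "x1 \<in> carrier H" "x2 \<in> carrier H"
      show "tensor_lift K (H \<boxtimes>\<^bsub>K\<^esub> H)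
          (\<lambda>y1 y2. pure_tensor K H H (\<alpha> (\<mu> x1 y1)) (\<alpha> (\<mu> x2 y2))) ?y
        = ?T (tensor_lift K (H \<boxtimes>\<^bsub>K\<^esub> H) (?f x1 x2) ?y)"
        unfolding linear_map_tensor_lift[OF H H inner[OF x12] T yt]
        by (rule tensor_lift_cong[OF H H linear_comp_bilinear[OF inner[OF x12] T] _ yt])
          (simp add: tensor_map_pure[OF \<alpha>_linear \<alpha>_linear] \<mu>_closed x12)
    qed
    finally show "\<Delta> (\<alpha> (\<alpha> (\<mu> x y))) = tensor_lift K (H \<boxtimes>\<^bsub>K\<^esub> H) (\<lambda>x1 x2.
        tensor_lift K (H \<boxtimes>\<^bsub>K\<^esub> H) (\<lambda>y1 y2. pure_tensor K H H (\<alpha> (\<mu> x1 y1)) (\<alpha> (\<mu> x2 y2))) ?y) ?x" .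
  qed (simp_all add: H \<alpha>_linear \<alpha>_mult \<alpha>_closed \<mu>_closed assoc \<alpha>_comult)
qed

theorem proposition2p3:
  fixes K :: "('k, 'r) ring_scheme"
    and H :: "('k, 'h, 'x) module_scheme"
    and M :: "('k, 'm, 'y) module_scheme"
    and \<mu> :: "'h \<Rightarrow> 'h \<Rightarrow> 'h"
    and \<Delta> :: "'h \<Rightarrow> ('h \<times> 'h \<Rightarrow> 'k) set"
    and act :: "'h \<Rightarrow> 'm \<Rightarrow> 'm"
    and \<rho> :: "'m \<Rightarrow> ('h \<times> 'm \<Rightarrow> 'k) set"
    and \<alpha>\<^sub>H :: "'h \<Rightarrow> 'h" and \<alpha>\<^sub>M :: "'m \<Rightarrow> 'm"
  assumes "bialgebra K H \<mu> \<Delta>"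
    and "bialgebra_endomorphism K H \<mu> \<Delta> \<alpha>\<^sub>H"
    and "yetter_drinfeld_module K H \<mu> \<Delta> M act \<rho>"
    and "linear_map K M M \<alpha>\<^sub>M"
    and "\<And>h m. \<lbrakk>h \<in> carrier H; m \<in> carrier M\<rbrakk> \<Longrightarrow> \<alpha>\<^sub>M (act h m) = act (\<alpha>\<^sub>H h) (\<alpha>\<^sub>M m)"
    and "\<And>m. m \<in> carrier M \<Longrightarrow> \<rho> (\<alpha>\<^sub>M m) = tensor_map K H M \<alpha>\<^sub>H \<alpha>\<^sub>M (\<rho> m)"
  shows "hom_yetter_drinfeld_module K
    H (\<lambda>x y. \<alpha>\<^sub>H (\<mu> x y)) (\<lambda>x. \<Delta> (\<alpha>\<^sub>H x)) \<alpha>\<^sub>H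
    M \<alpha>\<^sub>M (\<lambda>h m. \<alpha>\<^sub>M (act h m)) (\<lambda>m. \<rho> (\<alpha>\<^sub>M m))"
proof -
  interpret E: bialgebra_endomorphism K H \<mu> \<Delta> \<alpha>\<^sub>H by (rule assms(2))
  interpret Y: yetter_drinfeld_module K H \<mu> \<Delta> M act \<rho> by (rule assms(3))
  note H = E.vectorspace and M = Y.M_vectorspace
  note \<alpha>\<^sub>H = E.\<alpha>_linear and \<alpha>\<^sub>M = assms(4) and \<alpha>\<^sub>M_act = assms(5) and \<alpha>\<^sub>M_\<rho> = assms(6)
  note \<alpha>\<^sub>H_closed = linear_map.T_im[OF \<alpha>\<^sub>H] and \<alpha>\<^sub>M_closed = linear_map.T_im[OF \<alpha>\<^sub>M]
    and \<mu>_closed = bilinear_map_closed[OF E.\<mu>_bilinear]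
    and act_closed = bilinear_map_closed[OF Y.act_bilinear]
    and \<Delta>_closed = linear_map.T_im[OF E.\<Delta>_linear] and \<rho>_closed = linear_map.T_im[OF Y.\<rho>_linear]
  note closed = \<alpha>\<^sub>H_closed \<alpha>\<^sub>M_closed \<mu>_closed act_closed \<Delta>_closed \<rho>_closed
  note HM = tensor_space_vectorspace[OF H M] and p = pure_tensor_bilinear[OF H M]
  have com: "bialgebra_left_comodule K H \<mu> \<Delta> M \<rho>" ..
  let ?\<beta> = "\<lambda>x. \<alpha>\<^sub>H (\<alpha>\<^sub>H x)" and ?\<gamma> = "\<lambda>n. \<alpha>\<^sub>M (\<alpha>\<^sub>M n)"
  let ?T = "tensor_map K H M (\<lambda>x. \<alpha>\<^sub>H (\<alpha>\<^sub>H (\<alpha>\<^sub>H x))) ?\<gamma>"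
  have \<beta>: "linear_map K H H ?\<beta>" by (rule linear_map_comp[OF \<alpha>\<^sub>H \<alpha>\<^sub>H])
  have \<gamma>: "linear_map K M M ?\<gamma>" by (rule linear_map_comp[OF \<alpha>\<^sub>M \<alpha>\<^sub>M])
  note \<alpha>3 = linear_map_comp[OF \<beta> \<alpha>\<^sub>H]
  note T = tensor_map_linear[OF \<alpha>3 \<gamma>]
  have \<rho>_\<gamma>: "\<rho> (?\<gamma> n) = tensor_map K H M ?\<beta> ?\<gamma> (\<rho> n)" if "n \<in> carrier M" for n
    using that by (simp add: \<alpha>\<^sub>M_\<rho> closed tensor_map_comp[OF \<alpha>\<^sub>H \<alpha>\<^sub>M \<alpha>\<^sub>H \<alpha>\<^sub>M])
  show ?thesis
  proof (intro hom_yetter_drinfeld_module.intro hom_left_module.intro hom_left_module_axioms.intro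
      hom_left_comodule.intro hom_left_comodule_axioms.intro hom_yetter_drinfeld_module_axioms.intro
      twisted_bialgebra[OF assms(2)])
    show "bilinear_map K H M M (\<lambda>h m. \<alpha>\<^sub>M (act h m))"
      by (rule linear_comp_bilinear[OF Y.act_bilinear \<alpha>\<^sub>M])
    show "linear_map K M (H \<boxtimes>\<^bsub>K\<^esub> M) (\<lambda>m. \<rho> (\<alpha>\<^sub>M m))"
      by (rule linear_map_comp[OF \<alpha>\<^sub>M Y.\<rho>_linear])
    show "tensor_assoc K H H M (tensor_map K (H \<boxtimes>\<^bsub>K\<^esub> H) M (\<lambda>x. \<Delta> (\<alpha>\<^sub>H x)) \<alpha>\<^sub>M (\<rho> (\<alpha>\<^sub>M m)))
        = tensor_map K H (H \<boxtimes>\<^bsub>K\<^esub> M) \<alpha>\<^sub>H (\<lambda>m. \<rho> (\<alpha>\<^sub>M m)) (\<rho> (\<alpha>\<^sub>M m))" if "m \<in> carrier M" for m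
      by (rule twisted_coaction_hom_coassoc[OF assms(2) com \<alpha>\<^sub>M \<alpha>\<^sub>M_\<rho> that])
    fix h m assume h: "h \<in> carrier H" and m: "m \<in> carrier M"
    have d: "\<Delta> (\<alpha>\<^sub>H h) \<in> carrier (H \<boxtimes>\<^bsub>K\<^esub> H)" using h by (intro closed)
    have r: "\<rho> m \<in> carrier (H \<boxtimes>\<^bsub>K\<^esub> M)" using m by (intro closed)
    let ?l = "\<lambda>h2 x n. pure_tensor K H M (\<mu> x h2) n"
    let ?r = "\<lambda>h1 h2 x n. pure_tensor K H M (\<mu> h1 x) (act h2 n)"
    let ?lift = "tensor_lift K (H \<boxtimes>\<^bsub>K\<^esub> M)"
    have l_inner: "bilinear_map K H M (H \<boxtimes>\<^bsub>K\<^esub> M) (?l h2)" if "h2 \<in> carrier H" for h2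
      by (rule bilinear_map_comp[OF bilinear_mapD(2)[OF E.\<mu>_bilinear that] linear_map_ident[OF M] p])
    have l_outer: "bilinear_map K H H (H \<boxtimes>\<^bsub>K\<^esub> M) (\<lambda>h1 h2. ?lift (?l h2) (\<rho> (act h1 m)))"
    proof (rule bilinear_mapI)
      fix h1 assume h1: "h1 \<in> carrier H"
      show "linear_map K H (H \<boxtimes>\<^bsub>K\<^esub> M) (\<lambda>h2. ?lift (?l h2) (\<rho> (act h1 m)))"
        by (rule tensor_lift_param_linear[OF H M H l_inner _ \<rho>_closed[OF act_closed[OF h1 m]]])
          (assumption, rule linear_map_comp[OF bilinear_mapD(1)[OF E.\<mu>_bilinear] bilinear_mapD(2)[OF p]])
    next
      fix h2 assume h2: "h2 \<in> carrier H"
      show "linear_map K H (H \<boxtimes>\<^bsub>K\<^esub> M) (\<lambda>h1. ?lift (?l h2) (\<rho> (act h1 m)))"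
        by (rule linear_map_comp[OF linear_map_comp[OF bilinear_mapD(2)[OF Y.act_bilinear m]
                Y.\<rho>_linear] tensor_lift_linear[OF H M HM l_inner[OF h2]]])
    qed
    have r_inner: "bilinear_map K H M (H \<boxtimes>\<^bsub>K\<^esub> M) (?r h1 h2)"
      if "h1 \<in> carrier H" "h2 \<in> carrier H" for h1 h2
      by (rule bilinear_map_comp[OF bilinear_mapD(1)[OF E.\<mu>_bilinear that(1)]
            bilinear_mapD(1)[OF Y.act_bilinear that(2)] p])
    note r_outer = bilinear_tensor_lift_pure[OF H H H M E.\<mu>_bilinear Y.act_bilinear r]
    have "?lift (\<lambda>h1 h2. ?lift (\<lambda>x n. pure_tensor K H M (\<alpha>\<^sub>H (\<mu> x (\<alpha>\<^sub>H (\<alpha>\<^sub>H h2)))) n)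
          (\<rho> (\<alpha>\<^sub>M (\<alpha>\<^sub>M (act h1 m))))) (\<Delta> (\<alpha>\<^sub>H h))
      = ?lift (\<lambda>h1 h2. ?T (?lift (?l h2) (\<rho> (act h1 m)))) (\<Delta> (\<alpha>\<^sub>H h))"
    proof (rule tensor_lift_cong[OF H H linear_comp_bilinear[OF l_outer T] _ d])
      fix h1 h2 assume h12: "h1 \<in> carrier H" "h2 \<in> carrier H"
      have t: "\<rho> (act h1 m) \<in> carrier (H \<boxtimes>\<^bsub>K\<^esub> M)" using h12 m by (intro closed)
      have bil: "bilinear_map K H M (H \<boxtimes>\<^bsub>K\<^esub> M)
          (\<lambda>x n. pure_tensor K H M (\<alpha>\<^sub>H (\<mu> x (\<alpha>\<^sub>H (\<alpha>\<^sub>H h2)))) n)"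
        using h12
        by (intro bilinear_map_comp[OF linear_map_comp[OF bilinear_mapD(2)[OF E.\<mu>_bilinear] \<alpha>\<^sub>H]
              linear_map_ident[OF M] p] closed)
      have "?lift (\<lambda>x n. pure_tensor K H M (\<alpha>\<^sub>H (\<mu> x (\<alpha>\<^sub>H (\<alpha>\<^sub>H h2)))) n)
            (\<rho> (\<alpha>\<^sub>M (\<alpha>\<^sub>M (act h1 m))))
          = ?lift (\<lambda>x n. pure_tensor K H M (\<alpha>\<^sub>H (\<mu> (?\<beta> x) (?\<beta> h2))) (?\<gamma> n)) (\<rho> (act h1 m))"
        unfolding \<rho>_\<gamma>[OF act_closed[OF h12(1) m]]
        by (rule tensor_lift_tensor_map[OF \<beta> \<gamma> bil t])
      also have "\<dots> = ?lift (\<lambda>x n. ?T (?l h2 x n)) (\<rho> (act h1 m))"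
        by (rule tensor_lift_cong[OF H M linear_comp_bilinear[OF l_inner[OF h12(2)] T] _ t])
          (simp add: tensor_map_pure[OF \<alpha>3 \<gamma>] E.\<alpha>_mult closed h12)
      also have "\<dots> = ?T (?lift (?l h2) (\<rho> (act h1 m)))"
        by (rule linear_map_tensor_lift[OF H M l_inner[OF h12(2)] T t, symmetric])
      finally show "?lift (\<lambda>x n. pure_tensor K H M (\<alpha>\<^sub>H (\<mu> x (\<alpha>\<^sub>H (\<alpha>\<^sub>H h2)))) n)
            (\<rho> (\<alpha>\<^sub>M (\<alpha>\<^sub>M (act h1 m))))
          = ?T (?lift (?l h2) (\<rho> (act h1 m)))" .
    qed
    also have "\<dots> = ?T (?lift (\<lambda>h1 h2. ?lift (?l h2) (\<rho> (act h1 m))) (\<Delta> (\<alpha>\<^sub>H h)))"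
      by (rule linear_map_tensor_lift[OF H H l_outer T d, symmetric])
    also have "\<dots> = ?T (?lift (\<lambda>h1 h2. ?lift (?r h1 h2) (\<rho> m)) (\<Delta> (\<alpha>\<^sub>H h)))"
      by (simp only: Y.yetter_drinfeld[OF \<alpha>\<^sub>H_closed[OF h] m])
    also have "\<dots> = ?lift (\<lambda>h1 h2. ?T (?lift (?r h1 h2) (\<rho> m))) (\<Delta> (\<alpha>\<^sub>H h))"
      by (rule linear_map_tensor_lift[OF H H r_outer T d])
    also have "\<dots> = ?lift (\<lambda>h1 h2. ?lift (\<lambda>x n. pure_tensor K H M
          (\<alpha>\<^sub>H (\<mu> (\<alpha>\<^sub>H (\<alpha>\<^sub>H h1)) (\<alpha>\<^sub>H x))) (\<alpha>\<^sub>M (act (\<alpha>\<^sub>H h2) n))) (\<rho> (\<alpha>\<^sub>M m))) (\<Delta> (\<alpha>\<^sub>H h))"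
    proof (rule tensor_lift_cong[OF H H linear_comp_bilinear[OF r_outer T] _ d, symmetric])
      fix h1 h2 assume h12: "h1 \<in> carrier H" "h2 \<in> carrier H"
      have bil: "bilinear_map K H M (H \<boxtimes>\<^bsub>K\<^esub> M) (\<lambda>x n. pure_tensor K H M
          (\<alpha>\<^sub>H (\<mu> (\<alpha>\<^sub>H (\<alpha>\<^sub>H h1)) (\<alpha>\<^sub>H x))) (\<alpha>\<^sub>M (act (\<alpha>\<^sub>H h2) n)))"
        using h12
        by (intro bilinear_map_comp[OF
              linear_map_comp[OF linear_map_comp[OF \<alpha>\<^sub>H bilinear_mapD(1)[OF E.\<mu>_bilinear]] \<alpha>\<^sub>H]
              linear_map_comp[OF bilinear_mapD(1)[OF Y.act_bilinear] \<alpha>\<^sub>M] p] closed)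
      have "?lift (\<lambda>x n. pure_tensor K H M (\<alpha>\<^sub>H (\<mu> (\<alpha>\<^sub>H (\<alpha>\<^sub>H h1)) (\<alpha>\<^sub>H x)))
            (\<alpha>\<^sub>M (act (\<alpha>\<^sub>H h2) n))) (\<rho> (\<alpha>\<^sub>M m))
          = ?lift (\<lambda>x n. pure_tensor K H M (\<alpha>\<^sub>H (\<mu> (?\<beta> h1) (?\<beta> x)))
            (\<alpha>\<^sub>M (act (\<alpha>\<^sub>H h2) (\<alpha>\<^sub>M n)))) (\<rho> m)"
        unfolding \<alpha>\<^sub>M_\<rho>[OF m] by (rule tensor_lift_tensor_map[OF \<alpha>\<^sub>H \<alpha>\<^sub>M bil r])
      also have "\<dots> = ?lift (\<lambda>x n. ?T (?r h1 h2 x n)) (\<rho> m)"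
        by (rule tensor_lift_cong[OF H M linear_comp_bilinear[OF r_inner[OF h12] T] _ r])
          (simp add: tensor_map_pure[OF \<alpha>3 \<gamma>] E.\<alpha>_mult \<alpha>\<^sub>M_act closed h12)
      also have "\<dots> = ?T (?lift (?r h1 h2) (\<rho> m))"
        by (rule linear_map_tensor_lift[OF H M r_inner[OF h12] T r, symmetric])
      finally show "?lift (\<lambda>x n. pure_tensor K H M (\<alpha>\<^sub>H (\<mu> (\<alpha>\<^sub>H (\<alpha>\<^sub>H h1)) (\<alpha>\<^sub>H x)))
            (\<alpha>\<^sub>M (act (\<alpha>\<^sub>H h2) n))) (\<rho> (\<alpha>\<^sub>M m))
          = ?T (?lift (?r h1 h2) (\<rho> m))" .
    qed
    finally show "?lift (\<lambda>h1 h2. ?lift (\<lambda>x n. pure_tensor K H M (\<alpha>\<^sub>H (\<mu> x (\<alpha>\<^sub>H (\<alpha>\<^sub>H h2)))) n)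
          (\<rho> (\<alpha>\<^sub>M (\<alpha>\<^sub>M (act h1 m))))) (\<Delta> (\<alpha>\<^sub>H h))
      = ?lift (\<lambda>h1 h2. ?lift (\<lambda>x n. pure_tensor K H M
          (\<alpha>\<^sub>H (\<mu> (\<alpha>\<^sub>H (\<alpha>\<^sub>H h1)) (\<alpha>\<^sub>H x))) (\<alpha>\<^sub>M (act (\<alpha>\<^sub>H h2) n))) (\<rho> (\<alpha>\<^sub>M m))) (\<Delta> (\<alpha>\<^sub>H h))" .
  qed (simp_all add: \<alpha>\<^sub>M \<alpha>\<^sub>M_act \<alpha>\<^sub>M_\<rho> E.\<alpha>_mult Y.act_assoc closed)
qed

end
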